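(* Let $\mathcal N=\mathbb M_d$ and let $\Phi:\mathbb M_d\to\mathbb M_d$ be a completely positive trace-preserving map with a unique fixed state $\sigma$, where $\sigma$ has full rank. Assume additionally that $\Phi$ is strictly positive (it maps every state to a full-rank state). Then for any Lipschitz semi-norm $|||\cdot|||_L$ on $\mathbb M_d$, $$\eta^D(\Phi,\sigma)\le \mathrm{Lip}_L(\Phi^* )\,\max\left\{\mathrm{Lip}_L(\Phi^{*,\mathrm{BKM}}),\ \mathrm{LogLip}_L(\Phi,\sigma)\right\}.$$
   Context: States are density matrices; $S(\mathcal N)$ is their set. $D(\rho\|\sigma)=\mathrm{tr}[\rho(\log\rho-\log\sigma)]$ is the relative entropy, and $$\eta^D(\Phi,\sigma)=\sup_{\rho\in S(\mathcal N),\,\rho\ne\sigma}\frac{D(\Phi(\rho)\|\sigma)}{D(\rho\|\sigma)}.$$ $\Phi^*$ is the adjoint of $\Phi$ for the Hilbert–Schmidt inner product. $\Gamma_\sigma(x)=\int_0^1\sigma^s x\,\sigma^{1-s}ds$ and $\Phi^{*,\mathrm{BKM}}=\Gamma_\sigma^{-1}\circ\Phi\circ\Gamma_\sigma$. A Lipschitz semi-norm on $\mathbb M_d$ is a semi-norm $|||\cdot|||_L:\mathbb M_d\to[0,\infty)$ with $|||\mathbf 1|||_L=0$ and $|||x|||_L=|||x^*|||_L$. For a linear map $\Psi$ on $\mathbb M_d$, $\mathrm{Lip}_L(\Psi)=\sup\{|||\Psi(x)|||_L: x=x^*,\ |||x|||_L\le1\}$. Finally $$\mathrm{LogLip}_L(\Phi,\sigma)=\sup_{\rho\in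 S(\mathcal N),\ \rho>0}\frac{|||\log\Phi(\rho)-\log\sigma|||_L}{|||\log\rho-\log\sigma|||_L},$$ where quotients $0/0$ are disregarded and $c/0=\infty$ for $c>0$.
   Formalization: The Lipschitz semi-norm is additionally assumed to vanish only on scalar multiples of the identity; without this the inequality fails, e.g. for the zero semi-norm and a qubit depolarizing channel, where the right side is 0 but the contraction coefficient is positive. *)

theory Defs
  imports "HOL-Analysis.Analysis"
begin

text \<open>
  The algebra of complex d by d matrices is \<open>complex^'n^'n\<close> with \<open>d = CARD('n)\<close> and matrix
  product \<open>**\<close>; the symbol \<open>*\<close> on this type is the entrywise product and is not used.
\<close>

definition mscale :: "complex \<Rightarrow> complex^'n^'n \<Rightarrow> complex^'n^'n" where
  "mscale c A = map_matrix (\<lambda>z. c * z) A"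

definition mdagger :: "complex^'n^'n \<Rightarrow> complex^'n^'n" where
  "mdagger A = (\<chi> i j. cnj (A $ j $ i))"

definition self_adjoint :: "complex^'n^'n \<Rightarrow> bool" where
  "self_adjoint A \<longleftrightarrow> mdagger A = A"

definition unitary_matrix :: "complex^'n^'n \<Rightarrow> bool" where
  "unitary_matrix U \<longleftrightarrow> mdagger U ** U = mat 1 \<and> U ** mdagger U = mat 1"

definition diag_real :: "('n \<Rightarrow> real) \<Rightarrow> complex^'n^'n" where
  "diag_real l = (\<chi> i j. if i = j then complex_of_real (l i) else 0)"

definition cdot :: "complex^'n \<Rightarrow> complex^'n \<Rightarrow> complex" where
  "cdot v w = (\<Sum>i\<in>UNIV. cnj (v $ i) * w $ i)"

definition hs_inner :: "complex^'n^'n \<Rightarrow> complex^'n^'n \<Rightarrow> complex" where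
  "hs_inner A B = trace (mdagger A ** B)"


subsection \<open>States and channels\<close>

definition psd :: "complex^'n^'n \<Rightarrow> bool" where
  "psd A \<longleftrightarrow> (\<forall>v. cdot v (A *v v) \<in> \<real>\<^sub>\<ge>\<^sub>0)"

definition posdef :: "complex^'n^'n \<Rightarrow> bool" where
  "posdef A \<longleftrightarrow> (\<forall>v. v \<noteq> 0 \<longrightarrow> cdot v (A *v v) \<in> \<real>\<^sub>\<ge>\<^sub>0 - {0})"

definition states :: "(complex^'n^'n) set" where
  "states = {\<rho>. psd \<rho> \<and> trace \<rho> = 1}"

definition full_rank :: "complex^'n^'n \<Rightarrow> bool" where
  "full_rank A \<longleftrightarrow> rank A = CARD('n)"

text \<open>
  An element of the k by k matrices over \<open>complex^'n^'n\<close> is a family of blocks \<open>X i j\<close>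
  with \<open>i, j < k\<close>; it acts on k-tuples \<open>v\<close> of vectors, and the channel is applied blockwise.
\<close>

definition block_psd :: "nat \<Rightarrow> (nat \<Rightarrow> nat \<Rightarrow> complex^'n^'n) \<Rightarrow> bool" where
  "block_psd k X \<longleftrightarrow>
     (\<forall>v :: nat \<Rightarrow> complex^'n. (\<Sum>i<k. \<Sum>j<k. cdot (v i) (X i j *v v j)) \<in> \<real>\<^sub>\<ge>\<^sub>0)"

definition completely_positive :: "(complex^'n^'n \<Rightarrow> complex^'n^'n) \<Rightarrow> bool" where
  "completely_positive \<Phi> \<longleftrightarrow>
     Vector_Spaces.linear mscale mscale \<Phi> \<and>
     (\<forall>k X. block_psd k X \<longrightarrow> block_psd k (\<lambda>i j. \<Phi> (X i j)))"

definition trace_preserving :: "(complex^'n^'n \<Rightarrow> complex^'n^'n) \<Rightarrow> bool" where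
  "trace_preserving \<Phi> \<longleftrightarrow> (\<forall>X. trace (\<Phi> X) = trace X)"

definition unique_fixed_state :: "(complex^'n^'n \<Rightarrow> complex^'n^'n) \<Rightarrow> complex^'n^'n \<Rightarrow> bool" where
  "unique_fixed_state \<Phi> \<sigma> \<longleftrightarrow>
     \<sigma> \<in> states \<and> \<Phi> \<sigma> = \<sigma> \<and> (\<forall>\<tau>\<in>states. \<Phi> \<tau> = \<tau> \<longrightarrow> \<tau> = \<sigma>)"

definition strictly_positive :: "(complex^'n^'n \<Rightarrow> complex^'n^'n) \<Rightarrow> bool" where
  "strictly_positive \<Phi> \<longleftrightarrow> (\<forall>\<rho>\<in>states. \<Phi> \<rho> \<in> states \<and> full_rank (\<Phi> \<rho>))"


subsection \<open>Functional calculus and relative entropy\<close>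

text \<open>
  The functional calculus through a unitary diagonalisation. The value does not depend on the
  diagonalisation chosen (\<open>matfun_diag\<close> below); it is only meaningful for self-adjoint matrices.
\<close>

definition matfun :: "(real \<Rightarrow> real) \<Rightarrow> complex^'n^'n \<Rightarrow> complex^'n^'n" where
  "matfun f A = (THE B. \<exists>U l. unitary_matrix U \<and>
      A = U ** diag_real l ** mdagger U \<and>
      B = U ** diag_real (\<lambda>i. f (l i)) ** mdagger U)"

text \<open>
  As \<open>ln 0 = 0\<close>, the product of \<open>\<rho>\<close> and \<open>matlog \<rho>\<close> follows the convention \<open>0 log 0 = 0\<close>
  for singular states \<open>\<rho>\<close>.
\<close>

definition matlog :: "complex^'n^'n \<Rightarrow> complex^'n^'n" where
  "matlog A = matfun ln A"

definition matpow :: "complex^'n^'n \<Rightarrow> real \<Rightarrow> complex^'n^'n" where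
  "matpow A s = matfun (\<lambda>x. x powr s) A"

text \<open>
  The trace is real for self-adjoint arguments. The second argument is meant to be of full rank;
  the value infinity for states whose supports are not nested is not modelled.
\<close>

definition rel_entropy :: "complex^'n^'n \<Rightarrow> complex^'n^'n \<Rightarrow> real" where
  "rel_entropy \<rho> \<sigma> = Re (trace (\<rho> ** (matlog \<rho> - matlog \<sigma>)))"

definition eta_D :: "(complex^'n^'n \<Rightarrow> complex^'n^'n) \<Rightarrow> complex^'n^'n \<Rightarrow> ereal" where
  "eta_D \<Phi> \<sigma> = (SUP \<rho>\<in>{\<rho>. \<rho> \<in> states \<and> \<rho> \<noteq> \<sigma>}.
      ereal (rel_entropy (\<Phi> \<rho>) \<sigma>) / ereal (rel_entropy \<rho> \<sigma>))"


subsection \<open>Adjoints\<close>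

definition hs_adjoint :: "(complex^'n^'n \<Rightarrow> complex^'n^'n) \<Rightarrow> complex^'n^'n \<Rightarrow> complex^'n^'n" where
  "hs_adjoint \<Phi> = (THE \<Psi>. \<forall>X Y. hs_inner (\<Phi> X) Y = hs_inner X (\<Psi> Y))"

definition bkm_Gamma :: "complex^'n^'n \<Rightarrow> complex^'n^'n \<Rightarrow> complex^'n^'n" where
  "bkm_Gamma \<sigma> x = integral {0..1} (\<lambda>s. matpow \<sigma> s ** x ** matpow \<sigma> (1 - s))"

definition bkm_adjoint ::
    "(complex^'n^'n \<Rightarrow> complex^'n^'n) \<Rightarrow> complex^'n^'n \<Rightarrow> complex^'n^'n \<Rightarrow> complex^'n^'n" where
  "bkm_adjoint \<Phi> \<sigma> = inv (bkm_Gamma \<sigma>) \<circ> \<Phi> \<circ> bkm_Gamma \<sigma>"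


subsection \<open>Lipschitz semi-norms\<close>

definition lipschitz_seminorm :: "(complex^'n^'n \<Rightarrow> real) \<Rightarrow> bool" where
  "lipschitz_seminorm L \<longleftrightarrow>
     (\<forall>x. 0 \<le> L x) \<and>
     (\<forall>x y. L (x + y) \<le> L x + L y) \<and>
     (\<forall>c x. L (mscale c x) = cmod c * L x) \<and>
     L (mat 1) = 0 \<and>
     (\<forall>x. L (mdagger x) = L x)"

definition Lip :: "(complex^'n^'n \<Rightarrow> real) \<Rightarrow> (complex^'n^'n \<Rightarrow> complex^'n^'n) \<Rightarrow> ereal" where
  "Lip L \<Psi> = (SUP x\<in>{x. self_adjoint x \<and> L x \<le> 1}. ereal (L (\<Psi> x)))"

text \<open>
  Indices with quotient \<open>0/0\<close> are left out of the supremum; for \<open>c > 0\<close> the quotient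
  \<open>ereal c / 0\<close> is infinity.
\<close>

definition LogLip ::
    "(complex^'n^'n \<Rightarrow> real) \<Rightarrow> (complex^'n^'n \<Rightarrow> complex^'n^'n) \<Rightarrow> complex^'n^'n \<Rightarrow> ereal" where
  "LogLip L \<Phi> \<sigma> =
     (SUP \<rho>\<in>{\<rho>. \<rho> \<in> states \<and> posdef \<rho> \<and>
              \<not> (L (matlog (\<Phi> \<rho>) - matlog \<sigma>) = 0 \<and> L (matlog \<rho> - matlog \<sigma>) = 0)}.
        ereal (L (matlog (\<Phi> \<rho>) - matlog \<sigma>)) / ereal (L (matlog \<rho> - matlog \<sigma>)))"


subsection \<open>Well-definedness\<close>

lemma vector_space_mscale: "vector_space (mscale :: complex \<Rightarrow> complex^'n^'n \<Rightarrow> complex^'n^'n)"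
  by unfold_locales (simp_all add: mscale_def vec_eq_iff algebra_simps)

lemma diag_real_mult_right: "(A ** diag_real l) $ i $ j = A $ i $ j * complex_of_real (l j)"
  by (simp add: matrix_matrix_mult_def diag_real_def if_distrib cong: if_cong)

lemma diag_real_mult_left: "(diag_real l ** A) $ i $ j = complex_of_real (l i) * A $ i $ j"
  by (simp add: matrix_matrix_mult_def diag_real_def if_distrib if_distribR cong: if_cong)

lemma matfun_diag:
  fixes U :: "complex^'n^'n"
  assumes U: "unitary_matrix U"
  shows "matfun f (U ** diag_real l ** mdagger U) = U ** diag_real (\<lambda>i. f (l i)) ** mdagger U"
  unfolding matfun_def
proof (rule the_equality)
  show "\<exists>V m. unitary_matrix V \<and>
      U ** diag_real l ** mdagger U = V ** diag_real m ** mdagger V \<and>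
      U ** diag_real (\<lambda>i. f (l i)) ** mdagger U = V ** diag_real (\<lambda>i. f (m i)) ** mdagger V"
    using U by blast
next
  fix B
  assume "\<exists>V m. unitary_matrix V \<and>
      U ** diag_real l ** mdagger U = V ** diag_real m ** mdagger V \<and>
      B = V ** diag_real (\<lambda>i. f (m i)) ** mdagger V"
  then obtain V m where V: "unitary_matrix V"
    and eq: "U ** diag_real l ** mdagger U = V ** diag_real m ** mdagger V"
    and B: "B = V ** diag_real (\<lambda>i. f (m i)) ** mdagger V" by blast
  have UU: "mdagger U ** U = mat 1" "U ** mdagger U = mat 1"
    and VV: "mdagger V ** V = mat 1" "V ** mdagger V = mat 1"
    using U V by (auto simp: unitary_matrix_def)
  define W where "W = mdagger V ** U"
  have "mdagger V ** (U ** diag_real l ** mdagger U) ** U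
      = mdagger V ** (V ** diag_real m ** mdagger V) ** U" by (simp only: eq)
  moreover have "mdagger V ** (U ** diag_real l ** mdagger U) ** U
      = W ** diag_real l ** (mdagger U ** U)"
    by (simp only: W_def matrix_mul_assoc)
  moreover have "mdagger V ** (V ** diag_real m ** mdagger V) ** U
      = (mdagger V ** V) ** diag_real m ** W"
    by (simp only: W_def matrix_mul_assoc)
  ultimately have W: "W ** diag_real l = diag_real m ** W" by (simp add: UU VV)
  have "W ** diag_real (\<lambda>i. f (l i)) = diag_real (\<lambda>i. f (m i)) ** W"
  proof (simp only: vec_eq_iff diag_real_mult_left diag_real_mult_right, intro allI)
    fix i j
    have "W $ i $ j * complex_of_real (l j) = complex_of_real (m i) * W $ i $ j"
      using W by (metis diag_real_mult_left diag_real_mult_right)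
    then have "W $ i $ j = 0 \<or> l j = m i" by (simp add: mult.commute)
    then show "W $ i $ j * complex_of_real (f (l j)) = complex_of_real (f (m i)) * W $ i $ j"
      by auto
  qed
  then have "V ** (W ** diag_real (\<lambda>i. f (l i))) ** mdagger U
      = V ** (diag_real (\<lambda>i. f (m i)) ** W) ** mdagger U" by simp
  moreover have "V ** (W ** diag_real (\<lambda>i. f (l i))) ** mdagger U
      = (V ** mdagger V) ** U ** diag_real (\<lambda>i. f (l i)) ** mdagger U"
    by (simp only: W_def matrix_mul_assoc)
  moreover have "V ** (diag_real (\<lambda>i. f (m i)) ** W) ** mdagger U
      = V ** diag_real (\<lambda>i. f (m i)) ** mdagger V ** (U ** mdagger U)"
    by (simp only: W_def matrix_mul_assoc)
  ultimately show "B = U ** diag_real (\<lambda>i. f (l i)) ** mdagger U"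
    by (simp add: UU VV B)
qed

end

theory Submission
  imports Defs
begin

text \<open>
  Suppose that the contraction coefficient exceeds some \<open>c\<close> larger than the right-hand side. Then
  \<open>F \<rho> = D (\<Phi> \<rho>) \<sigma> - c * D \<rho> \<sigma>\<close> takes a positive value on the compact set of states, so its
  maximiser \<open>\<rho>\<close> differs from \<open>\<sigma>\<close>, where \<open>F\<close> vanishes. The maximiser has full rank, since the
  entropy of a singular state has infinite slope towards the interior while \<open>\<Phi>\<close> maps all states
  into the interior. The first-order condition at \<open>\<rho>\<close> is
  \<open>\<Phi>\<^sup>* (log (\<Phi> \<rho>) - log \<sigma>) = c (log \<rho> - log \<sigma>) + b 1\<close>; applying the semi-norm bounds \<open>c\<close> by
  \<open>Lip \<Phi>\<^sup>* * LogLip\<close>. Because \<open>F\<close> replaces the quotient, maximising sequences that converge to \<open>\<sigma>\<close>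
  do not arise, and the BKM adjoint enters only through the nonnegativity of its Lipschitz constant.
  Differentiability of the entropy is replaced throughout by Klein's inequality
  \<open>tr y log y \<ge> tr y log x\<close>.
\<close>

subsection \<open>Complex matrices\<close>

lemma cdot_add_left: "cdot (u + v) w = cdot u w + cdot v w"
  and cdot_add_right: "cdot w (u + v) = cdot w u + cdot w v"
  and cdot_scale_left: "cdot (c *s v) w = cnj c * cdot v w"
  and cdot_scale_right: "cdot v (c *s w) = c * cdot v w"
  and cdot_diff_right: "cdot w (u - v) = cdot w u - cdot w v"
  and cdot_zero_right: "cdot w 0 = 0"
  by (simp_all add: cdot_def algebra_simps sum.distrib sum_distrib_left sum_subtractf)

lemma cnj_cdot: "cnj (cdot v w) = cdot w v"
  by (simp add: cdot_def mult.commute)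

lemma cdot_self: "cdot v v = of_real (\<Sum>i\<in>UNIV. (cmod (v $ i))\<^sup>2)"
  by (simp add: cdot_def complex_norm_square mult.commute del: of_real_power)

lemma mdagger_nth [simp]: "mdagger A $ i $ j = cnj (A $ j $ i)"
  by (simp add: mdagger_def)

lemma mdagger_mdagger [simp]: "mdagger (mdagger A) = A"
  by (simp add: vec_eq_iff)

lemma mdagger_mat_1 [simp]: "mdagger (mat 1 :: complex^'n^'n) = mat 1"
  by (auto simp: vec_eq_iff mat_def)

lemma mdagger_mult: "mdagger (A ** B) = mdagger B ** mdagger A"
  by (simp add: vec_eq_iff matrix_matrix_mult_def mult.commute)

lemma mdagger_diff: "mdagger (A - B) = mdagger A - mdagger B"
  by (simp add: vec_eq_iff)

lemma mdagger_scaleR: "mdagger (r *\<^sub>R A) = r *\<^sub>R mdagger A"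
  by (simp add: vec_eq_iff)

lemma mdagger_diag_real [simp]: "mdagger (diag_real l) = diag_real l"
  by (simp add: vec_eq_iff diag_real_def)

lemma mscale_of_real: "mscale (of_real r) A = r *\<^sub>R A"
  by (simp add: vec_eq_iff mscale_def) (simp add: scaleR_conv_of_real)

lemma trace_scaleR: "trace (r *\<^sub>R A) = r *\<^sub>R trace (A :: complex^'n^'n)"
  by (simp add: trace_def scaleR_sum_right)

lemma scaleR_matrix_mult:
  "(r *\<^sub>R A) ** B = r *\<^sub>R (A ** (B :: complex^'n^'n))"
  by (simp add: vec_eq_iff matrix_matrix_mult_def scaleR_sum_right)

lemma matrix_add_rdistrib: "(B + C) ** A = B ** A + C ** (A :: complex^'n^'n)"
  by (simp add: vec_eq_iff matrix_matrix_mult_def algebra_simps sum.distrib)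

lemma matrix_diff_ldistrib: "A ** (B - C) = A ** B - A ** (C :: complex^'n^'n)"
  by (simp add: vec_eq_iff matrix_matrix_mult_def algebra_simps sum_subtractf)

lemma matrix_diff_rdistrib: "(B - C) ** A = B ** A - C ** (A :: complex^'n^'n)"
  by (simp add: vec_eq_iff matrix_matrix_mult_def algebra_simps sum_subtractf)

lemma cdot_adjoint: "cdot v (A *v w) = cdot (mdagger A *v v) w"
  unfolding cdot_def matrix_vector_mult_def
  by (simp add: sum_distrib_left sum_distrib_right algebra_simps) (rule sum.swap)

text \<open>Entries of a change of basis are sesquilinear forms of columns, so matrix identities
  reduce to statements about \<open>cdot\<close>; with \<open>A = mat 1\<close> they become
  statements about orthonormality.\<close>

lemma conjugate_nth:
  "(mdagger U ** A ** V) $ i $ j = cdot (column i U) (A *v column j V)"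
  unfolding cdot_def column_def matrix_vector_mult_def matrix_matrix_mult_def
  by (simp add: sum_distrib_left sum_distrib_right algebra_simps) (rule sum.swap)

text \<open>For square matrices a left inverse is also a right inverse, so orthonormality of the
  columns is enough.\<close>

lemma unitary_iff_orthonormal:
  "unitary_matrix U \<longleftrightarrow> (\<forall>i j. cdot (column i U) (column j U) = (if i = j then 1 else 0))"
proof -
  have "(mdagger U ** U) $ i $ j = cdot (column i U) (column j U)" for i j
    using conjugate_nth[of U "mat 1" U i j] by simp
  then have "mdagger U ** U = mat 1 \<longleftrightarrow>
      (\<forall>i j. cdot (column i U) (column j U) = (if i = j then 1 else 0))"
    by (simp add: vec_eq_iff mat_def)
  then show ?thesis
    unfolding unitary_matrix_def using matrix_left_right_inverse by blast
qed

lemma unitary_mat_1: "unitary_matrix (mat 1)"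
  by (simp add: unitary_matrix_def)

lemma unitary_mult_cancel:
  assumes "unitary_matrix U"
  shows "mdagger U ** U = mat 1" "U ** mdagger U = mat 1"
    "mdagger U ** (U ** A) = A" "U ** (mdagger U ** A) = A"
    "A ** U ** mdagger U = A" "A ** mdagger U ** U = A"
  using assms unfolding unitary_matrix_def
  by (simp_all add: matrix_mul_assoc) (simp_all flip: matrix_mul_assoc)

subsection \<open>Spectral theorem\<close>

lemma continuous_on_matrix_mult [continuous_intros]:
  fixes f g :: "'a::topological_space \<Rightarrow> complex^'n^'n"
  assumes "continuous_on S f" "continuous_on S g"
  shows "continuous_on S (\<lambda>x. f x ** g x)"
  unfolding matrix_matrix_mult_def using assms by (intro continuous_intros)

lemma continuous_on_mdagger [continuous_intros]:
  fixes f :: "'a::topological_space \<Rightarrow> complex^'n^'n"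
  assumes "continuous_on S f"
  shows "continuous_on S (\<lambda>x. mdagger (f x))"
  unfolding mdagger_def using assms by (intro continuous_intros)

lemma continuous_on_trace [continuous_intros]:
  fixes f :: "'a::topological_space \<Rightarrow> complex^'n^'n"
  assumes "continuous_on S f"
  shows "continuous_on S (\<lambda>x. trace (f x))"
  unfolding trace_def using assms by (intro continuous_intros)

lemma continuous_on_diag_real [continuous_intros]:
  fixes f :: "'a::topological_space \<Rightarrow> 'n::finite \<Rightarrow> real"
  assumes "\<And>i. continuous_on S (\<lambda>x. f x i)"
  shows "continuous_on S (\<lambda>x. diag_real (f x) :: complex^'n^'n)"
  unfolding diag_real_def
proof (intro continuous_intros)
  fix i j
  show "continuous_on S (\<lambda>x. if i = j then complex_of_real (f x i) else 0)"
    using assms by (cases "i = j") (auto intro!: continuous_intros)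
qed

text \<open>Unit columns bound every entry by 1. Compactness supplies the maximiser in the
  diagonalisation and, later, compactness of the set of states.\<close>

lemma compact_unitary: "compact {U :: complex^'n^'n. unitary_matrix U}"
proof -
  have "closed ({U :: complex^'n^'n. mdagger U ** U = mat 1} \<inter> {U. U ** mdagger U = mat 1})"
    by (intro closed_Int closed_Collect_eq continuous_intros)
  then have "closed {U :: complex^'n^'n. unitary_matrix U}"
    by (simp add: unitary_matrix_def Collect_conj_eq)
  moreover have "bounded {U :: complex^'n^'n. unitary_matrix U}"
  proof (rule boundedI)
    fix U :: "complex^'n^'n" assume "U \<in> {U. unitary_matrix U}"
    then have U: "unitary_matrix U" by simp
    have entry: "cmod (U $ i $ j) \<le> 1" for i j
    proof -
      have "cdot (column j U) (column j U) = 1"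
        using U by (simp add: unitary_iff_orthonormal)
      then have "(\<Sum>i\<in>UNIV. (cmod (U $ i $ j))\<^sup>2) = 1"
        by (simp add: cdot_self column_def del: of_real_sum of_real_power)
      moreover have "(cmod (U $ i $ j))\<^sup>2 \<le> (\<Sum>i\<in>UNIV. (cmod (U $ i $ j))\<^sup>2)"
        by (rule member_le_sum) auto
      ultimately show ?thesis by (simp add: power2_le_iff_abs_le abs_square_le_1)
    qed
    have "norm U \<le> (\<Sum>i\<in>UNIV. norm (U $ i))"
      unfolding norm_vec_def by (rule L2_set_le_sum) auto
    also have "\<dots> \<le> (\<Sum>i\<in>UNIV. \<Sum>j\<in>UNIV. cmod (U $ i $ j))"
      unfolding norm_vec_def[of "_ $ _"] by (intro sum_mono L2_set_le_sum) auto
    also have "\<dots> \<le> (\<Sum>i\<in>(UNIV::'n set). \<Sum>j\<in>(UNIV::'n set). 1)"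
      by (intro sum_mono entry)
    finally show "norm U \<le> (\<Sum>i\<in>(UNIV::'n set). \<Sum>j\<in>(UNIV::'n set). 1)" .
  qed
  ultimately show ?thesis by (simp add: compact_eq_bounded_closed)
qed

text \<open>A two-dimensional unitary is applied to columns \<open>p\<close> and \<open>q\<close>
  alone. The free phase \<open>w\<close> allows the rotation to be aligned with the phase of an
  off-diagonal entry.\<close>

lemma two_level_rotation:
  fixes U :: "complex^'n^'n" and w :: complex and t :: real
  assumes U: "unitary_matrix U" and w: "cmod w = 1" and pq: "p \<noteq> q"
  obtains V where "unitary_matrix V"
    "column p V = of_real (cos t) *s column p U + (w * of_real (sin t)) *s column q U"
    "column q V = (- cnj w * of_real (sin t)) *s column p U + of_real (cos t) *s column q U"
    "\<And>i. i \<noteq> p \<Longrightarrow> i \<noteq> q \<Longrightarrow> column i V = column i U"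
proof -
  define a b where "a = complex_of_real (cos t)" and "b = w * of_real (sin t)"
  have "b * cnj b = of_real ((cmod b)\<^sup>2)" by (rule complex_norm_square[symmetric])
  then have ab: "cnj a = a" "a * a + b * cnj b = 1"
    using w by (simp_all add: a_def b_def norm_mult flip: of_real_power of_real_mult of_real_add power2_eq_square)
  have b': "- cnj w * of_real (sin t) = - cnj b" by (simp add: b_def)
  define d where "d = - cnj b"
  have cd: "cnj d = - b" by (simp add: d_def)
  define v where "v j = (if j = p then a *s column p U + b *s column q U
     else if j = q then d *s column p U + a *s column q U
     else column j U)" for j
  define V :: "complex^'n^'n" where "V = (\<chi> i j. v j $ i)"
  have col: "column j V = v j" for j by (simp add: V_def column_def)
  have orth: "cdot (column i U) (column j U) = (if i = j then 1 else 0)" for i j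
    using U by (simp add: unitary_iff_orthonormal)
  have ab': "b * cnj b + a * a = 1" "cnj b * b + a * a = 1" "a * a + cnj b * b = 1"
    using ab by (simp_all add: algebra_simps)
  have other: "cdot (v i) (v j) = (if i = j then 1 else 0)" if "j \<noteq> p" "j \<noteq> q" for i j
    using that by (simp add: v_def cdot_add_left cdot_scale_left orth)
  have "cdot (v p) (v p) = 1" "cdot (v q) (v q) = 1" "cdot (v p) (v q) = 0"
    using pq ab ab'
    by (simp_all add: v_def cdot_add_left cdot_add_right cdot_scale_left cdot_scale_right orth cd)
       (simp_all add: d_def)
  then have "cdot (v i) (v j) = (if i = j then 1 else 0)" for i j
    using other[of j i] other[of i j] cnj_cdot[of "v i" "v j"] pq
    by (cases "i = p"; cases "i = q"; cases "j = p"; cases "j = q") auto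
  then have "unitary_matrix V" by (simp add: unitary_iff_orthonormal col)
  then show thesis using that[of V] pq unfolding b' col by (simp add: v_def flip: a_def b_def d_def)
qed

text \<open>
  A maximiser of \<open>\<Sum>i. c i * (U\<^sup>* A U) i i\<close> over the unitaries, for distinct weights \<open>c i\<close>,
  diagonalises \<open>A\<close>: otherwise a rotation in some coordinate plane increases the sum to first order.
\<close>

theorem self_adjoint_diagonalization:
  fixes A :: "complex^'n^'n"
  assumes A: "self_adjoint A"
  obtains U l where "unitary_matrix U" "A = U ** diag_real l ** mdagger U"
proof -
  \<comment> \<open>An injection into the naturals yields distinct weights; with equal weights the
    sum would be invariant under rotations of the corresponding coordinate plane.\<close>
  obtain c0 :: "'n \<Rightarrow> nat" where c0: "inj c0"
    using finite_imp_inj_to_nat_seg[of "UNIV :: 'n set"] by auto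
  define c :: "'n \<Rightarrow> real" where "c i = real (c0 i)" for i
  have cinj: "c p \<noteq> c q" if "p \<noteq> q" for p q
    using c0 that by (simp add: c_def inj_eq)
  define Q where "Q v = Re (cdot v (A *v v))" for v
  define f where "f U = (\<Sum>i\<in>UNIV. c i * Q (column i U))" for U :: "complex^'n^'n"
  have f_alt: "f = (\<lambda>U. \<Sum>i\<in>UNIV. c i * Re ((mdagger U ** A ** U) $ i $ i))"
    by (simp add: f_def Q_def conjugate_nth fun_eq_iff)
  have "continuous_on {U. unitary_matrix U} f"
    unfolding f_alt by (intro continuous_intros)
  then obtain U where U: "unitary_matrix U" and max: "\<And>V. unitary_matrix V \<Longrightarrow> f V \<le> f U"
    using continuous_attains_sup[OF compact_unitary, of f] unitary_mat_1 by auto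
  have herm: "cdot v (A *v w) = cnj (cdot w (A *v v))" for v w
    using A by (metis cdot_adjoint cnj_cdot self_adjoint_def)
  have off: "cdot (column p U) (A *v column q U) = 0" if pq: "p \<noteq> q" for p q
  proof (rule ccontr)
    define z where "z = cdot (column p U) (A *v column q U)"
    assume "cdot (column p U) (A *v column q U) \<noteq> 0"
    then have z: "z \<noteq> 0" by (simp add: z_def)
    \<comment> \<open>This phase turns \<open>w * z\<close> into the modulus of \<open>z\<close>, so
      the off-diagonal entry contributes with full size.\<close>
    define w where "w = cnj z / cmod z"
    have w: "cmod w = 1" using z by (simp add: w_def norm_divide)
    have Re_of_real_mult: "Re (of_real r * x) = r * Re x" for r x by simp
    have wz: "Re (w * z) = cmod z"
    proof -
      have "cnj z * z = of_real (cmod z) * of_real (cmod z)"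
        using complex_norm_square[of z] by (simp only: power2_eq_square of_real_mult mult.commute)
      moreover have "complex_of_real (cmod z) \<noteq> 0" using z by simp
      ultimately have "w * z = of_real (cmod z)"
        unfolding w_def times_divide_eq_left by (metis nonzero_mult_div_cancel_left)
      then show ?thesis by simp
    qed
    have zqp: "cdot (column q U) (A *v column p U) = cnj z"
      unfolding z_def by (rule herm)
    define P R where "P = Q (column p U)" and "R = Q (column q U)"
    \<comment> \<open>\<open>g t\<close> is the gain \<open>f V - f U\<close> under the rotation by
      the angle \<open>t\<close>.\<close>
    define g where "g t = (c p - c q) * ((sin t)\<^sup>2 * (R - P) + 2 * sin t * cos t * cmod z)" for t
    have "g t \<le> 0" for t
    proof -
      obtain V where V: "unitary_matrix V" and
        vp: "column p V = of_real (cos t) *s column p U + (w * of_real (sin t)) *s column q U" and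
        vq: "column q V = (- cnj w * of_real (sin t)) *s column p U + of_real (cos t) *s column q U"
        and vi: "\<And>i. i \<noteq> p \<Longrightarrow> i \<noteq> q \<Longrightarrow> column i V = column i U"
        using two_level_rotation[OF U w pq] by metis
      have qs: "Q (a *s x + b *s y) = (cmod a)\<^sup>2 * Q x + (cmod b)\<^sup>2 * Q y
          + 2 * Re (cnj a * b * cdot x (A *v y))" for a b x y
      proof -
        have 1: "cdot (a *s x + b *s y) (A *v (a *s x + b *s y)) = (cnj a * a) * cdot x (A *v x)
           + (cnj b * b) * cdot y (A *v y) + cnj a * b * cdot x (A *v y)
           + cnj b * a * cdot y (A *v x)"
          by (simp add: cdot_add_left cdot_add_right cdot_scale_left cdot_scale_right
              matrix_vector_right_distrib vector_scalar_commute algebra_simps)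
        have 2: "cnj b * a * cdot y (A *v x) = cnj (cnj a * b * cdot x (A *v y))"
          unfolding herm[of y x] by (simp add: algebra_simps)
        have 3: "cnj a * a = of_real ((cmod a)\<^sup>2)" "cnj b * b = of_real ((cmod b)\<^sup>2)"
          by (simp_all add: complex_norm_square mult.commute del: of_real_power)
        show ?thesis unfolding Q_def 1 2 3 by (simp add: algebra_simps)
      qed
      have 1: "Q (column p V) = (cos t)\<^sup>2 * P + (sin t)\<^sup>2 * R + 2 * sin t * cos t * cmod z"
      proof -
        have "cnj (of_real (cos t)) * (w * of_real (sin t)) * z = of_real (sin t * cos t) * (w * z)"
          by simp
        then have "Re (cnj (of_real (cos t)) * (w * of_real (sin t)) * z) = sin t * cos t * cmod z"
          by (simp only: Re_of_real_mult wz)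
        then show ?thesis
          unfolding vp qs P_def R_def z_def[symmetric] using w by (simp add: norm_mult)
      qed
      have 2: "Q (column q V) = (sin t)\<^sup>2 * P + (cos t)\<^sup>2 * R - 2 * sin t * cos t * cmod z"
      proof -
        have "cnj (- cnj w * of_real (sin t)) * of_real (cos t) * z = of_real (- (sin t * cos t)) * (w * z)"
          by simp
        then have "Re (cnj (- cnj w * of_real (sin t)) * of_real (cos t) * z) = - (sin t * cos t) * cmod z"
          by (simp only: Re_of_real_mult wz)
        then show ?thesis
          unfolding vq qs P_def R_def z_def[symmetric] using w by (simp add: norm_mult)
      qed
      have split: "f W = c p * Q (column p W) + c q * Q (column q W)
          + (\<Sum>i\<in>UNIV - {p, q}. c i * Q (column i W))" for W
        unfolding f_def using pq
        by (subst sum.subset_diff[of "{p, q}"]) auto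
      have "f V - f U = c p * (Q (column p V) - P) + c q * (Q (column q V) - R)"
        unfolding split using vi by (simp add: P_def R_def algebra_simps)
      also have "\<dots> = g t"
        unfolding 1 2 g_def cos_squared_eq by (simp add: algebra_simps)
      finally show ?thesis using max[OF V] by simp
    qed
    then have "\<forall>y. \<bar>0 - y\<bar> < 1 \<longrightarrow> g y \<le> g 0" by (simp add: g_def[of 0])
    \<comment> \<open>The term quadratic in the sine has no slope at 0; what remains must vanish at
      a maximum, although the weights differ and \<open>z\<close> is nonzero.\<close>
    moreover have "(g has_real_derivative (c p - c q) * (2 * cmod z)) (at 0)"
      unfolding g_def by (auto intro!: derivative_eq_intros)
    ultimately have "(c p - c q) * (2 * cmod z) = 0"
      by (intro DERIV_local_max[of g _ 0 1]) auto
    then show False using z cinj[OF pq] by simp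
  qed
  define l where "l i = Q (column i U)" for i
  have "mdagger U ** A ** U = diag_real l"
    unfolding vec_eq_iff
  proof (intro allI)
    fix i j
    show "(mdagger U ** A ** U) $ i $ j = diag_real l $ i $ j"
    proof (cases "i = j")
      case True
      have "cdot (column i U) (A *v column i U) \<in> \<real>"
        using herm[of "column i U" "column i U"] by (metis Reals_cnj_iff)
      then show ?thesis
        using True by (simp add: conjugate_nth diag_real_def l_def Q_def)
    qed (simp add: conjugate_nth off diag_real_def)
  qed
  then have "A = U ** diag_real l ** mdagger U"
    using unitary_mult_cancel[OF U] by (metis matrix_mul_assoc)
  then show thesis using that U by blast
qed

subsection \<open>Spectral form of positive matrices\<close>

abbreviation conj_diag :: "complex^'n^'n \<Rightarrow> ('n \<Rightarrow> real) \<Rightarrow> complex^'n^'n" where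
  "conj_diag U l \<equiv> U ** diag_real l ** mdagger U"

text \<open>Polarisation over the complex numbers: the test vectors \<open>e i + c *s e j\<close>
  with \<open>c = 1\<close> and \<open>c = \<i>\<close> separate the two entries
  \<open>N $ i $ j\<close> and \<open>N $ j $ i\<close>.\<close>

lemma quad_form_eq_0_imp:
  fixes N :: "complex^'n^'n"
  assumes "\<And>v. cdot v (N *v v) = 0"
  shows "N = 0"
proof -
  define e where "e i = column i (mat 1 :: complex^'n^'n)" for i
  have ent: "cdot (e i) (N *v e j) = N $ i $ j" for i j
    using conjugate_nth[of "mat 1" N "mat 1" i j] by (simp add: e_def)
  have exp: "c * N $ i $ j + cnj c * N $ j $ i = 0" for c i j
  proof -
    have "cdot (e i + c *s e j) (N *v (e i + c *s e j)) = N $ i $ i + cnj c * c * N $ j $ j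
        + (c * N $ i $ j + cnj c * N $ j $ i)"
      by (simp add: cdot_add_left cdot_add_right cdot_scale_left cdot_scale_right
          matrix_vector_right_distrib vector_scalar_commute ent algebra_simps)
    moreover have "N $ k $ k = 0" for k using assms[of "e k"] ent by simp
    ultimately show ?thesis using assms by simp
  qed
  have "N $ i $ j = 0" for i j
    using exp[of 1 i j] exp[of \<i> i j] by (simp add: complex_eq_iff)
  then show ?thesis by (simp add: vec_eq_iff)
qed

text \<open>The form of \<open>mdagger A - A\<close> vanishes identically. This recovers
  self-adjointness for \<open>psd\<close>, whose definition only speaks of the quadratic
  form.\<close>

lemma quad_form_real_imp_self_adjoint:
  assumes "\<And>v. cdot v (A *v v) \<in> \<real>"
  shows "self_adjoint A"
proof -
  have "cdot v ((mdagger A - A) *v v) = 0" for v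
  proof -
    have "cdot v (mdagger A *v v) = cnj (cdot v (A *v v))"
      by (simp add: cdot_adjoint[of v A] cnj_cdot)
    also have "\<dots> = cdot v (A *v v)" using assms by (simp add: Reals_cnj_iff)
    finally show ?thesis by (simp add: matrix_vector_mult_diff_rdistrib cdot_diff_right)
  qed
  then have "mdagger A - A = 0" by (rule quad_form_eq_0_imp)
  then show ?thesis by (simp add: self_adjoint_def)
qed

lemma psd_imp_self_adjoint: "psd A \<Longrightarrow> self_adjoint A"
  by (rule quad_form_real_imp_self_adjoint) (auto simp: psd_def nonneg_Reals_subset_Reals[THEN subsetD])

lemma self_adjoint_diff: "self_adjoint A \<Longrightarrow> self_adjoint B \<Longrightarrow> self_adjoint (A - B)"
  by (simp add: self_adjoint_def mdagger_diff)

lemma self_adjoint_scaleR: "self_adjoint A \<Longrightarrow> self_adjoint (r *\<^sub>R A)"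
  by (simp add: self_adjoint_def mdagger_scaleR)

lemma self_adjoint_conj_diag: "self_adjoint (conj_diag U l)"
  by (simp add: self_adjoint_def mdagger_mult matrix_mul_assoc)

lemma quad_form_conj_diag:
  "cdot v (conj_diag U l *v v) = of_real (\<Sum>i\<in>UNIV. l i * (cmod ((mdagger U *v v) $ i))\<^sup>2)"
proof -
  define x where "x = mdagger U *v v"
  have "cdot v (conj_diag U l *v v) = cdot x (diag_real l *v x)"
    by (simp add: x_def cdot_adjoint[of v U] matrix_vector_mul_assoc[symmetric])
  also have "(diag_real l *v x) $ i = of_real (l i) * x $ i" for i
    by (simp add: matrix_vector_mult_def diag_real_def if_distrib if_distribR cong: if_cong)
  then have "cdot x (diag_real l *v x) = (\<Sum>i\<in>UNIV. of_real (l i) * (cnj (x $ i) * x $ i))"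
    unfolding cdot_def by (simp add: mult_ac)
  also have "\<dots> = of_real (\<Sum>i\<in>UNIV. l i * (cmod (x $ i))\<^sup>2)"
    by (simp add: complex_norm_square mult.commute del: of_real_power)
  finally show ?thesis by (simp add: x_def)
qed

lemma quad_form_eigenvector:
  assumes "unitary_matrix U"
  shows "cdot (column i U) (conj_diag U l *v column i U) = of_real (l i)"
proof -
  have "mdagger U ** conj_diag U l ** U = diag_real l"
    using unitary_mult_cancel[OF assms] by (simp flip: matrix_mul_assoc)
  then show ?thesis
    using conjugate_nth[of U "conj_diag U l" U i i] by (simp add: diag_real_def)
qed

lemma psd_conj_diag_iff:
  assumes U: "unitary_matrix U"
  shows "psd (conj_diag U l) \<longleftrightarrow> (\<forall>i. 0 \<le> l i)"
proof
  assume "psd (conj_diag U l)"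
  then show "\<forall>i. 0 \<le> l i"
    unfolding psd_def using quad_form_eigenvector[OF U] by (metis nonneg_Reals_of_real_iff)
next
  assume "\<forall>i. 0 \<le> l i"
  then show "psd (conj_diag U l)"
    unfolding psd_def quad_form_conj_diag nonneg_Reals_of_real_iff by (auto intro!: sum_nonneg)
qed

lemma posdef_conj_diag_iff:
  assumes U: "unitary_matrix U"
  shows "posdef (conj_diag U l) \<longleftrightarrow> (\<forall>i. 0 < l i)"
proof
  assume pd: "posdef (conj_diag U l)"
  show "\<forall>i. 0 < l i"
  proof
    fix i
    have "cdot (column i U) (column i U) = 1" using U by (simp add: unitary_iff_orthonormal)
    then have "column i U \<noteq> 0" by (auto simp: cdot_zero_right)
    then have "of_real (l i) \<in> \<real>\<^sub>\<ge>\<^sub>0 - {0 :: complex}"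
      using pd quad_form_eigenvector[OF U] unfolding posdef_def by metis
    then show "0 < l i" by auto
  qed
next
  assume l: "\<forall>i. 0 < l i"
  show "posdef (conj_diag U l)"
    unfolding posdef_def
  proof (intro allI impI)
    fix v :: "complex^'a" assume v: "v \<noteq> 0"
    define x where "x = mdagger U *v v"
    have "U *v x = v" unfolding x_def using unitary_mult_cancel[OF U]
      by (simp add: matrix_vector_mul_assoc)
    then have "x \<noteq> 0" using v by auto
    then obtain k where k: "x $ k \<noteq> 0" by (auto simp: vec_eq_iff)
    have "0 < (\<Sum>i\<in>UNIV. l i * (cmod (x $ i))\<^sup>2)"
      by (rule sum_pos2[of _ k]) (use k l in \<open>auto simp: less_imp_le\<close>)
    then show "cdot v (conj_diag U l *v v) \<in> \<real>\<^sub>\<ge>\<^sub>0 - {0}"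
      unfolding quad_form_conj_diag x_def[symmetric] by (simp del: of_real_sum)
  qed
qed

lemma trace_conj_diag:
  assumes "unitary_matrix U"
  shows "trace (conj_diag U l) = of_real (\<Sum>i\<in>UNIV. l i)"
proof -
  have "trace (conj_diag U l) = trace (mdagger U ** (U ** diag_real l))"
    by (rule trace_mul_sym)
  then show ?thesis
    by (simp only: unitary_mult_cancel(3)[OF assms]) (simp add: trace_def diag_real_def)
qed

lemma conj_diag_in_states_iff:
  assumes "unitary_matrix U"
  shows "conj_diag U l \<in> states \<longleftrightarrow> (\<forall>i. 0 \<le> l i) \<and> (\<Sum>i\<in>UNIV. l i) = 1"
  unfolding states_def
  by (simp add: psd_conj_diag_iff[OF assms] trace_conj_diag[OF assms] del: of_real_sum)

lemma states_imp_self_adjoint: "\<rho> \<in> states \<Longrightarrow> self_adjoint \<rho>"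
  by (simp add: states_def psd_imp_self_adjoint)

lemma states_spectral:
  assumes "\<rho> \<in> states"
  obtains U l where "unitary_matrix U" "\<rho> = conj_diag U l" "\<And>i. 0 \<le> l i"
    "(\<Sum>i\<in>UNIV. l i) = 1" "\<And>i. l i \<le> 1"
proof -
  obtain U l where U: "unitary_matrix U" and \<rho>: "\<rho> = conj_diag U l"
    using self_adjoint_diagonalization states_imp_self_adjoint[OF assms] by blast
  have l: "\<forall>i. 0 \<le> l i" "(\<Sum>i\<in>UNIV. l i) = 1"
    using assms by (simp_all add: \<rho> conj_diag_in_states_iff[OF U])
  have "l i \<le> 1" for i
    using member_le_sum[of i UNIV l] l by simp
  then show thesis using that U \<rho> l by blast
qed

lemma posdef_states_spectral:
  assumes "\<rho> \<in> states" "posdef \<rho>"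
  obtains U l where "unitary_matrix U" "\<rho> = conj_diag U l" "\<And>i. 0 < l i"
    "(\<Sum>i\<in>UNIV. l i) = 1" "\<And>i. l i \<le> 1"
  using states_spectral[OF assms(1)] posdef_conj_diag_iff assms(2) by metis

lemma full_rank_imp_inj:
  assumes "full_rank A" "A *v v = 0"
  shows "v = 0"
proof -
  have "vec.span (rows A) = UNIV"
    using assms(1)
    by (simp add: full_rank_def row_rank_def_gen vec.dimension_def card_cart_basis vec.dim_eq_full[symmetric])
  then have "\<exists>B. B ** A = mat 1" by (simp add: matrix_left_invertible_span_rows_gen)
  then show ?thesis using assms(2) by (metis matrix_left_invertible_ker)
qed

text \<open>A zero eigenvalue would put a unit column of \<open>U\<close> into the kernel.\<close>

lemma full_rank_state_posdef:
  assumes "\<rho> \<in> states" "full_rank \<rho>"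
  shows "posdef \<rho>"
proof -
  obtain U l where U: "unitary_matrix U" and \<rho>: "\<rho> = conj_diag U l" and l: "\<And>i. 0 \<le> l i"
    using states_spectral[OF assms(1)] by metis
  have "l i \<noteq> 0" for i
  proof
    assume li: "l i = 0"
    have "conj_diag U l *v column i U = 0"
    proof -
      have "conj_diag U l ** U = U ** diag_real l"
        using unitary_mult_cancel[OF U] by (simp flip: matrix_mul_assoc)
      moreover have "(conj_diag U l *v column i U) $ j = (conj_diag U l ** U) $ j $ i" for j
        by (simp add: matrix_vector_mult_def matrix_matrix_mult_def[of _ U] column_def)
      ultimately show ?thesis using li by (simp add: vec_eq_iff diag_real_mult_right)
    qed
    then have "column i U = 0" using full_rank_imp_inj assms(2) \<rho> by blast
    moreover have "cdot (column i U) (column i U) = 1" using U by (simp add: unitary_iff_orthonormal)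
    ultimately show False by (simp add: cdot_zero_right)
  qed
  then show ?thesis unfolding \<rho> posdef_conj_diag_iff[OF U] using l by (simp add: less_le)
qed

subsection \<open>Continuity of the functional calculus\<close>

text \<open>A continuous map from a compact space to a Hausdorff space is a quotient map onto its
  image, so continuity of \<open>h\<close> can be tested after composition with \<open>g\<close>.
  Diagonalisations are not unique, and this avoids having to choose them continuously.\<close>

lemma continuous_on_compact_image:
  fixes g :: "'a::topological_space \<Rightarrow> 'b::t2_space" and h :: "'b \<Rightarrow> 'c::topological_space"
  assumes K: "compact K" and g: "continuous_on K g" and hg: "continuous_on K (\<lambda>x. h (g x))"
  shows "continuous_on (g ` K) h"
  unfolding continuous_on_closed_invariant
proof (intro allI impI)
  fix B :: "'c set" assume "closed B"
  then obtain A where A: "closed A" "A \<inter> K = (\<lambda>x. h (g x)) -` B \<inter> K"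
    using hg unfolding continuous_on_closed_invariant by blast
  have "compact (A \<inter> K)" using A(1) K by (rule closed_Int_compact)
  then have "compact (g ` (A \<inter> K))"
    using g by (intro compact_continuous_image) (auto intro: continuous_on_subset)
  then have "closed (g ` (A \<inter> K))" by (rule compact_imp_closed)
  moreover have "g ` (A \<inter> K) \<inter> g ` K = h -` B \<inter> g ` K" using A(2) by auto
  ultimately show "\<exists>A. closed A \<and> A \<inter> g ` K = h -` B \<inter> g ` K" by blast
qed

text \<open>By the spectral theorem these are the self-adjoint matrices with spectrum inside
  \<open>I\<close>. In this form the set is a continuous image of a compact set when
  \<open>I\<close> is a compact interval.\<close>

definition spectrum_in :: "real set \<Rightarrow> (complex^'n^'n) set" where
  "spectrum_in I = {conj_diag U l | U l. unitary_matrix U \<and> (\<forall>i. l i \<in> I)}"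

lemma compact_unitary_times_box:
  "compact ({U :: complex^'n^'n. unitary_matrix U} \<times> {l :: real^'n. \<forall>i. l $ i \<in> {a..b}})"
proof -
  have "{l :: real^'n. \<forall>i. l $ i \<in> {a..b}} = cbox (\<chi> i. a) (\<chi> i. b)"
    by (auto simp: mem_box_cart)
  then show ?thesis by (simp add: compact_Times compact_unitary)
qed

lemma continuous_on_conj_diag:
  assumes "\<And>i. continuous_on S (\<lambda>x. f x i)"
  shows "continuous_on (T \<times> S) (\<lambda>(U, l). conj_diag U (f l))"
proof -
  have "continuous_on (T \<times> S) (\<lambda>x. f (snd x) i)" for i
    by (rule continuous_on_compose2[OF assms]) (auto intro: continuous_intros)
  then show ?thesis unfolding case_prod_beta by (intro continuous_intros)
qed

lemma spectrum_in_eq_image: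
  "spectrum_in I = (\<lambda>(U, l :: real^'n). conj_diag U (($) l)) `
     ({U :: complex^'n^'n. unitary_matrix U} \<times> {l. \<forall>i. l $ i \<in> I})"
proof (intro set_eqI iffI)
  fix A :: "complex^'n^'n" assume "A \<in> spectrum_in I"
  then obtain U l where "unitary_matrix U" "\<forall>i. l i \<in> I" "A = conj_diag U l"
    unfolding spectrum_in_def by blast
  then show "A \<in> (\<lambda>(U, l :: real^'n). conj_diag U (($) l)) `
     ({U :: complex^'n^'n. unitary_matrix U} \<times> {l. \<forall>i. l $ i \<in> I})"
    by (intro image_eqI[of _ _ "(U, \<chi> i. l i)"]) (auto simp: vec_lambda_inverse)
qed (auto simp: spectrum_in_def)

text \<open>Pulled back to pairs of a unitary and an eigenvalue vector, the functional calculus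
  merely applies \<open>f\<close> to each eigenvalue, which is visibly continuous.\<close>

lemma continuous_on_matfun:
  fixes f :: "real \<Rightarrow> real"
  assumes f: "continuous_on {a..b} f"
  shows "continuous_on (spectrum_in {a..b} :: (complex^'n^'n) set) (matfun f)"
  unfolding spectrum_in_eq_image
proof (rule continuous_on_compact_image)
  let ?K = "{U :: complex^'n^'n. unitary_matrix U} \<times> {l :: real^'n. \<forall>i. l $ i \<in> {a..b}}"
  show "compact ?K" by (rule compact_unitary_times_box)
  show "continuous_on ?K (\<lambda>(U, l). conj_diag U (($) l))"
    by (intro continuous_on_conj_diag continuous_intros)
  have "continuous_on ?K (\<lambda>(U, l). conj_diag U (\<lambda>i. f (l $ i)))"
    by (intro continuous_on_conj_diag continuous_on_compose2[OF f]) (auto intro: continuous_intros)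
  then show "continuous_on ?K (\<lambda>x. matfun f (case x of (U, l) \<Rightarrow> conj_diag U (($) l)))"
    by (rule continuous_on_eq) (auto simp: matfun_diag)
qed

lemma states_subset_spectrum_in: "states \<subseteq> spectrum_in {0..1}"
proof
  fix \<rho> :: "complex^'n^'n" assume "\<rho> \<in> states"
  then show "\<rho> \<in> spectrum_in {0..1}"
    unfolding spectrum_in_def by (elim states_spectral) auto
qed

text \<open>Positivity and trace one confine the eigenvalues to the unit interval, so the states are
  a closed slice of a compact set.\<close>

lemma compact_states: "compact (states :: (complex^'n^'n) set)"
proof -
  let ?g = "\<lambda>(U :: complex^'n^'n, l :: real^'n). conj_diag U (($) l)"
  let ?K = "{U :: complex^'n^'n. unitary_matrix U} \<times> {l :: real^'n. \<forall>i. l $ i \<in> {0..1}}"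
  have "continuous_on ?K ?g"
    by (intro continuous_on_conj_diag continuous_intros)
  then have "compact (spectrum_in {0..1} :: (complex^'n^'n) set)"
    unfolding spectrum_in_eq_image by (intro compact_continuous_image compact_unitary_times_box)
  moreover have "closed {A :: complex^'n^'n. trace A = 1}"
    by (intro closed_Collect_eq continuous_intros)
  ultimately have "compact (spectrum_in {0..1} \<inter> {A :: complex^'n^'n. trace A = 1})"
    by (rule compact_Int_closed)
  moreover have "spectrum_in {0..1} \<inter> {A :: complex^'n^'n. trace A = 1} = states"
    using states_subset_spectrum_in
    by (auto simp: spectrum_in_def states_def psd_conj_diag_iff)
  ultimately show ?thesis by simp
qed

subsection \<open>Relative entropy\<close>

definition neg_entropy :: "complex^'n^'n \<Rightarrow> real" where
  "neg_entropy \<rho> = Re (trace (\<rho> ** matlog \<rho>))"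

text \<open>Isolates the nonlinear part; what remains is real-linear in \<rho>.\<close>

lemma rel_entropy_eq: "rel_entropy \<rho> \<sigma> = neg_entropy \<rho> - Re (trace (\<rho> ** matlog \<sigma>))"
  by (simp add: rel_entropy_def neg_entropy_def matrix_diff_ldistrib trace_sub)

lemma matlog_conj_diag:
  "unitary_matrix U \<Longrightarrow> matlog (conj_diag U l) = conj_diag U (\<lambda>i. ln (l i))"
  by (simp add: matlog_def matfun_diag)

lemma self_adjoint_matlog: "self_adjoint A \<Longrightarrow> self_adjoint (matlog A)"
  by (elim self_adjoint_diagonalization) (simp add: matlog_conj_diag self_adjoint_conj_diag)

section \<open>Trace pairings of two spectral forms and Klein's inequality\<close>

lemma conj_diag_mult:
  assumes "unitary_matrix U"
  shows "conj_diag U l ** conj_diag U m = conj_diag U (\<lambda>i. l i * m i)"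
proof -
  have "conj_diag U l ** conj_diag U m = U ** (diag_real l ** diag_real m) ** mdagger U"
    using unitary_mult_cancel[OF assms] by (simp flip: matrix_mul_assoc)
  moreover have "diag_real l ** diag_real m = (diag_real (\<lambda>i. l i * m i) :: complex^'a^'a)"
    by (simp add: vec_eq_iff diag_real_mult_left) (simp add: diag_real_def)
  ultimately show ?thesis by simp
qed

text \<open>The weights are the squared overlaps of the two eigenbases, a doubly stochastic matrix.
  They reduce trace inequalities for noncommuting matrices to scalar ones; the last clause handles
  equality cases: eigenvalues need only agree where the eigenvectors overlap.\<close>

lemma trace_conj_diag_mult:
  fixes U V :: "complex^'n^'n"
  assumes U: "unitary_matrix U" and V: "unitary_matrix V"
  obtains w where "\<And>i j. 0 \<le> w i j" "\<And>i. (\<Sum>j\<in>UNIV. w i j) = 1" "\<And>j. (\<Sum>i\<in>UNIV. w i j) = 1"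
    "\<And>l m. Re (trace (conj_diag U l ** conj_diag V m)) = (\<Sum>i\<in>UNIV. \<Sum>j\<in>UNIV. w i j * (l i * m j))"
    "\<And>l m. (\<And>i j. w i j = 0 \<or> l i = m j) \<Longrightarrow> conj_diag U l = conj_diag V m"
proof -
  define W where "W = mdagger U ** V"
  define w where "w i j = (cmod (W $ i $ j))\<^sup>2" for i j
  have W': "mdagger W = mdagger V ** U" by (simp add: W_def mdagger_mult)
  have WW: "mdagger W ** W = mat 1" "W ** mdagger W = mat 1"
    using unitary_mult_cancel[OF U] unitary_mult_cancel[OF V]
    unfolding W' by (simp_all add: W_def flip: matrix_mul_assoc)
  have sq: "a * cnj a = of_real ((cmod a)\<^sup>2)" "cnj a * a = of_real ((cmod a)\<^sup>2)" for a
    by (simp_all add: complex_norm_square mult.commute del: of_real_power)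
  have "complex_of_real (\<Sum>j\<in>UNIV. w i j) = (W ** mdagger W) $ i $ i" for i
    by (simp add: matrix_matrix_mult_def w_def sq del: of_real_power)
  then have 1: "(\<Sum>j\<in>UNIV. w i j) = 1" for i
    unfolding WW mat_def by (simp flip: of_real_sum)
  have "complex_of_real (\<Sum>i\<in>UNIV. w i j) = (mdagger W ** W) $ j $ j" for j
    by (simp add: matrix_matrix_mult_def w_def sq del: of_real_power)
  then have 2: "(\<Sum>i\<in>UNIV. w i j) = 1" for j
    unfolding WW mat_def by (simp flip: of_real_sum)
  have 3: "Re (trace (conj_diag U l ** conj_diag V m)) = (\<Sum>i\<in>UNIV. \<Sum>j\<in>UNIV. w i j * (l i * m j))" for l m
  proof -
    have "trace (conj_diag U l ** conj_diag V m)
        = trace ((U ** diag_real l) ** (W ** diag_real m ** mdagger V))"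
      by (simp add: W_def matrix_mul_assoc)
    also have "\<dots> = trace ((W ** diag_real m ** mdagger V) ** (U ** diag_real l))"
      by (rule trace_mul_sym)
    also have "\<dots> = trace ((W ** diag_real m) ** mdagger W ** diag_real l)"
      by (simp add: W' matrix_mul_assoc)
    also have "\<dots> = (\<Sum>i\<in>UNIV. (\<Sum>j\<in>UNIV. (W $ i $ j * of_real (m j)) * cnj (W $ i $ j)) * of_real (l i))"
      unfolding trace_def diag_real_mult_right
      by (simp add: matrix_matrix_mult_def[of _ "mdagger W"] diag_real_mult_right)
    also have "\<dots> = (\<Sum>i\<in>UNIV. \<Sum>j\<in>UNIV. of_real (w i j * (l i * m j)))"
      unfolding sum_distrib_right w_def of_real_mult sq[symmetric]
      by (intro sum.cong refl) (simp only: mult_ac)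
    finally show ?thesis by (simp flip: of_real_sum)
  qed
  have 4: "conj_diag U l = conj_diag V m" if "\<And>i j. w i j = 0 \<or> l i = m j" for l m
  proof -
    have "W $ i $ j * of_real (m j) = of_real (l i) * W $ i $ j" for i j
      using that[of i j] by (auto simp: w_def)
    then have "W ** diag_real m = diag_real l ** W"
      by (simp add: vec_eq_iff diag_real_mult_left diag_real_mult_right)
    then have "U ** (W ** diag_real m) ** mdagger V = U ** (diag_real l ** W) ** mdagger V" by simp
    then show ?thesis
      using unitary_mult_cancel[OF U] unitary_mult_cancel[OF V] by (simp add: W_def flip: matrix_mul_assoc)
  qed
  show thesis by (rule that[of w]) (use 1 2 3 4 in \<open>auto simp: w_def\<close>)
qed

text \<open>The tangent inequality for the strictly convex function \<open>x * ln x\<close> at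
  \<open>q\<close>, obtained from \<open>ln y \<le> y - 1\<close> at \<open>y = q / p\<close>;
  \<open>p = 0\<close> is treated separately.\<close>

lemma ln_gradient_le:
  fixes p q :: real
  assumes "0 \<le> p" "0 < q"
  shows "p - q \<le> p * ln p - p * ln q"
    and "p * ln p - p * ln q = p - q \<Longrightarrow> p = q"
proof -
  have *: "p - q \<le> p * ln p - p * ln q \<and> (p * ln p - p * ln q = p - q \<longrightarrow> p = q)"
  proof (cases "p = 0")
    case False
    then have p: "p > 0" using assms by simp
    have "ln (q / p) \<le> q / p - 1" using p assms by (intro ln_le_minus_one) simp
    then have "p * ln (q / p) \<le> p * (q / p - 1)" using p by simp
    moreover have "p * ln (q / p) = p * ln q - p * ln p" "p * (q / p - 1) = q - p"
      using p assms by (simp_all add: ln_div algebra_simps)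
    moreover have "p = q" if "p * ln p - p * ln q = p - q"
    proof -
      have "p * ln (q / p) = p * (q / p - 1)" using calculation that by simp
      then have "ln (q / p) = q / p - 1" using p by simp
      then have "q / p = 1" using p assms by (intro ln_eq_minus_one) auto
      then show ?thesis using p by simp
    qed
    ultimately show ?thesis by simp
  qed (use assms in auto)
  then show "p - q \<le> p * ln p - p * ln q" "p * ln p - p * ln q = p - q \<Longrightarrow> p = q" by auto
qed

text \<open>The relative entropy is an overlap-weighted sum of scalar tangent gaps. If it vanishes,
  each gap with positive weight vanishes, so overlapping eigenvectors carry equal
  eigenvalues.\<close>

theorem klein_inequality:
  assumes \<rho>: "\<rho> \<in> states" and \<tau>: "\<tau> \<in> states" "posdef \<tau>"
  shows "0 \<le> rel_entropy \<rho> \<tau>" and "rel_entropy \<rho> \<tau> = 0 \<Longrightarrow> \<rho> = \<tau>"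
proof -
  obtain U p where U: "unitary_matrix U" and \<rho>_eq: "\<rho> = conj_diag U p" and p: "\<And>i. 0 \<le> p i"
    and p1: "(\<Sum>i\<in>UNIV. p i) = 1" using states_spectral[OF \<rho>] by metis
  obtain V q where V: "unitary_matrix V" and \<tau>_eq: "\<tau> = conj_diag V q" and q: "\<And>i. 0 < q i"
    and q1: "(\<Sum>i\<in>UNIV. q i) = 1" using posdef_states_spectral[OF \<tau>] by metis
  obtain w where w: "\<And>i j. 0 \<le> w i j" and w1: "\<And>i. (\<Sum>j\<in>UNIV. w i j) = 1"
    and w2: "\<And>j. (\<Sum>i\<in>UNIV. w i j) = 1"
    and tr: "\<And>l m. Re (trace (conj_diag U l ** conj_diag V m)) = (\<Sum>i\<in>UNIV. \<Sum>j\<in>UNIV. w i j * (l i * m j))"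
    and eq: "\<And>l m. (\<And>i j. w i j = 0 \<or> l i = m j) \<Longrightarrow> conj_diag U l = conj_diag V m"
    by (rule trace_conj_diag_mult[OF U V]) blast
  have row: "(\<Sum>i\<in>UNIV. \<Sum>j\<in>UNIV. w i j * f i) = (\<Sum>i\<in>UNIV. f i)" for f :: "'a \<Rightarrow> real"
    using w1 by (simp flip: sum_distrib_right)
  have col: "(\<Sum>i\<in>UNIV. \<Sum>j\<in>UNIV. w i j * f j) = (\<Sum>j\<in>UNIV. f j)" for f :: "'a \<Rightarrow> real"
    using w2 by (subst sum.swap) (simp flip: sum_distrib_right)
  have "neg_entropy \<rho> = (\<Sum>i\<in>UNIV. p i * ln (p i))"
    unfolding neg_entropy_def \<rho>_eq matlog_conj_diag[OF U] conj_diag_mult[OF U] trace_conj_diag[OF U]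
    by (simp only: Re_complex_of_real)
  \<comment> \<open>The added terms \<open>p i - q j\<close> cancel in the weighted sum, since the
    weights are doubly stochastic and both traces are one.\<close>
  define T where "T i j = w i j * (p i * ln (p i) - p i * ln (q j) - (p i - q j))" for i j
  have T_eq: "T i j = w i j * (p i * ln (p i)) - w i j * (p i * ln (q j)) - (w i j * p i - w i j * q j)" for i j
    by (simp add: T_def right_diff_distrib)
  have "(\<Sum>i\<in>UNIV. \<Sum>j\<in>UNIV. T i j) = (\<Sum>i\<in>UNIV. p i * ln (p i))
      - Re (trace (\<rho> ** matlog \<tau>))"
    unfolding T_eq sum_subtractf row col p1 q1 \<rho>_eq \<tau>_eq matlog_conj_diag[OF V] tr by simp
  then have rel: "rel_entropy \<rho> \<tau> = (\<Sum>i\<in>UNIV. \<Sum>j\<in>UNIV. T i j)"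
    using \<open>neg_entropy \<rho> = _\<close> by (simp only: rel_entropy_eq)
  have nn: "0 \<le> T i j" for i j
    unfolding T_def using ln_gradient_le(1)[OF p[of i] q[of j]] w by simp
  then show "0 \<le> rel_entropy \<rho> \<tau>" unfolding rel by (intro sum_nonneg)
  assume "rel_entropy \<rho> \<tau> = 0"
  then have "(\<Sum>j\<in>UNIV. T i j) = 0" for i
    unfolding rel using sum_nonneg_eq_0_iff[of UNIV "\<lambda>i. \<Sum>j\<in>UNIV. T i j"] nn by (simp add: sum_nonneg)
  then have "T i j = 0" for i j
    using sum_nonneg_eq_0_iff[of UNIV "T i"] nn by simp
  then have "w i j = 0 \<or> p i = q j" for i j
    using ln_gradient_le(2)[OF p[of i] q[of j]] unfolding T_def mult_eq_0_iff by auto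
  then show "\<rho> = \<tau>" unfolding \<rho>_eq \<tau>_eq by (rule eq)
qed

lemma continuous_on_x_ln_x: "continuous_on {0..b} (\<lambda>x::real. x * ln x)"
  unfolding continuous_on_def
proof
  fix x assume x: "x \<in> {0..b}"
  show "((\<lambda>x. x * ln x) \<longlongrightarrow> x * ln x) (at x within {0..b})"
  proof (cases "x = 0")
    case True
    \<comment> \<open>With \<open>y = inverse x\<close> the function becomes
      \<open>- ln y / y\<close> as \<open>y\<close> tends to infinity.\<close>
    have "((\<lambda>x::real. - (ln (inverse x) / inverse x)) \<longlongrightarrow> - 0) (at_right 0)"
      by (intro tendsto_minus filterlim_compose[OF ln_x_over_x_tendsto_0 filterlim_inverse_at_top_right])
    moreover have "\<forall>\<^sub>F x::real in at_right 0. - (ln (inverse x) / inverse x) = x * ln x"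
      using eventually_at_right_less[of 0] by eventually_elim (simp add: ln_inverse divide_inverse)
    ultimately have "((\<lambda>x::real. x * ln x) \<longlongrightarrow> 0) (at_right 0)"
      by (simp add: tendsto_cong)
    moreover have "at (0::real) within {0..b} \<le> at_right 0"
      unfolding at_within_def by (intro inf_mono order_refl) auto
    ultimately have "((\<lambda>x::real. x * ln x) \<longlongrightarrow> 0) (at 0 within {0..b})"
      by (metis tendsto_mono)
    then show ?thesis using True by simp
  qed (use x in \<open>auto intro!: tendsto_intros\<close>)
qed

text \<open>The logarithm is discontinuous at singular states, so the product is treated as the
  functional calculus of the single function \<open>x * ln x\<close>, continuous down to 0.\<close>

lemma continuous_on_neg_entropy: "continuous_on states neg_entropy"
proof -
  have "continuous_on states (\<lambda>\<rho>::complex^'n^'n. Re (trace (matfun (\<lambda>x. x * ln x) \<rho>)))"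
    by (intro continuous_intros continuous_on_subset[OF continuous_on_matfun states_subset_spectrum_in]
        continuous_on_x_ln_x)
  then show ?thesis
  proof (rule continuous_on_eq)
    fix \<rho> :: "complex^'n^'n" assume "\<rho> \<in> states"
    then obtain U l where "unitary_matrix U" "\<rho> = conj_diag U l" using states_spectral by metis
    then show "Re (trace (matfun (\<lambda>x. x * ln x) \<rho>)) = neg_entropy \<rho>"
      by (simp add: neg_entropy_def matfun_diag matlog_conj_diag conj_diag_mult)
  qed
qed

subsection \<open>Adjoints of linear maps\<close>

lemma hs_inner_eq_sum: "hs_inner A B = (\<Sum>i\<in>UNIV. \<Sum>j\<in>UNIV. cnj (A $ i $ j) * B $ i $ j)"
  unfolding hs_inner_def trace_def matrix_matrix_mult_def by simp (rule sum.swap)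

lemma hs_inner_self_adjoint: "self_adjoint A \<Longrightarrow> hs_inner A B = trace (A ** B)"
  by (simp add: hs_inner_def self_adjoint_def)

lemma hs_inner_mscale_left: "hs_inner (mscale c A) B = cnj c * hs_inner A B"
  by (simp add: hs_inner_eq_sum mscale_def sum_distrib_left mult_ac)

lemma hs_inner_sum_left: "hs_inner (sum f S) B = (\<Sum>x\<in>S. hs_inner (f x) B)"
proof (induction S rule: infinite_finite_induct)
  case (insert x S)
  then show ?case by (simp add: hs_inner_eq_sum algebra_simps sum.distrib)
qed (simp_all add: hs_inner_eq_sum)

definition mat_unit :: "'n \<Rightarrow> 'n \<Rightarrow> complex^'n^'n" where
  "mat_unit i j = (\<chi> k l. if i = k \<and> j = l then 1 else 0)"

lemma mat_unit_sum:
  fixes f :: "'n::finite \<Rightarrow> 'n \<Rightarrow> complex"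
  shows "(\<Sum>i\<in>UNIV. \<Sum>j\<in>UNIV. (if i = k \<and> j = l then 1 else 0) * f i j) = f k l"
proof -
  have "(\<Sum>j\<in>UNIV. (if i = k \<and> j = l then 1 else 0) * f i j) = (if i = k then f i l else 0)" for i
    by (cases "i = k") (simp_all add: if_distrib if_distribR cong: if_cong)
  then show ?thesis by simp
qed

lemma mat_unit_expansion: "A = (\<Sum>i\<in>UNIV. \<Sum>j\<in>UNIV. mscale (A $ i $ j) (mat_unit i j))"
  using mat_unit_sum[of _ _ "\<lambda>i j. A $ i $ j"]
  by (simp add: vec_eq_iff mscale_def mat_unit_def mult.commute[of "A $ _ $ _"])

lemma hs_inner_mat_unit: "hs_inner (mat_unit i j) B = B $ i $ j"
proof -
  have "hs_inner (mat_unit i j) B = (\<Sum>k\<in>UNIV. \<Sum>l\<in>UNIV. (if k = i \<and> l = j then 1 else 0) * B $ k $ l)"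
    unfolding hs_inner_eq_sum by (intro sum.cong refl) (auto simp: mat_unit_def)
  then show ?thesis by (simp only: mat_unit_sum)
qed

lemma hs_inner_eqI:
  assumes "\<And>X. hs_inner X A = hs_inner X B"
  shows "A = B"
  using assms[of "mat_unit _ _"] by (simp add: hs_inner_mat_unit vec_eq_iff)

lemma hs_adjoint_eqI:
  assumes "\<And>X Y. hs_inner (\<Phi> X) Y = hs_inner X (\<Psi> Y)"
  shows "hs_adjoint \<Phi> = \<Psi>"
  unfolding hs_adjoint_def
proof (rule the_equality)
  fix \<Psi>' assume "\<forall>X Y. hs_inner (\<Phi> X) Y = hs_inner X (\<Psi>' Y)"
  then show "\<Psi>' = \<Psi>" using assms by (intro ext hs_inner_eqI) metis
qed (use assms in blast)

text \<open>An adjoint is built entrywise from the images of the matrix units; uniqueness identifies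
  it with the description in \<open>hs_adjoint\<close>.\<close>

lemma hs_adjoint:
  assumes "Vector_Spaces.linear mscale mscale \<Phi>"
  shows "hs_inner (\<Phi> X) Y = hs_inner X (hs_adjoint \<Phi> Y)"
proof -
  interpret \<Phi>: Vector_Spaces.linear mscale mscale \<Phi> by fact
  define \<Psi> where "\<Psi> Y = (\<chi> i j. hs_inner (\<Phi> (mat_unit i j)) Y)" for Y
  have "hs_inner (\<Phi> X) Y = hs_inner X (\<Psi> Y)" for X Y
  proof -
    have "\<Phi> X = (\<Sum>i\<in>UNIV. \<Sum>j\<in>UNIV. mscale (X $ i $ j) (\<Phi> (mat_unit i j)))"
      by (subst mat_unit_expansion[of X]) (simp add: \<Phi>.sum \<Phi>.scale)
    then show ?thesis
      by (simp add: hs_inner_sum_left hs_inner_mscale_left)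
        (simp add: hs_inner_eq_sum[of X] \<Psi>_def)
  qed
  then show ?thesis using hs_adjoint_eqI[of \<Phi> \<Psi>] by simp
qed

text \<open>Dual to trace preservation, because pairing with a scalar matrix reads off the
  trace.\<close>

lemma hs_adjoint_unital:
  assumes "Vector_Spaces.linear mscale mscale \<Phi>" and "trace_preserving \<Phi>"
  shows "hs_adjoint \<Phi> (mscale c (mat 1)) = mscale c (mat 1)"
proof (rule hs_inner_eqI)
  fix X
  have *: "hs_inner Z (mscale c (mat 1)) = cnj (trace Z) * c" for Z :: "complex^'a^'a"
    by (simp add: hs_inner_eq_sum mscale_def mat_def trace_def sum_distrib_right if_distrib sum.delta cong: if_cong)
  show "hs_inner X (hs_adjoint \<Phi> (mscale c (mat 1))) = hs_inner X (mscale c (mat 1))"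
    using assms(2) by (simp add: hs_adjoint[OF assms(1), symmetric] * trace_preserving_def)
qed

lemma completely_positive_psd:
  assumes "completely_positive \<Phi>" "psd A"
  shows "psd (\<Phi> A)"
proof -
  \<comment> \<open>Ordinary positivity is the case of a single block.\<close>
  have *: "block_psd 1 (\<lambda>i j. B) \<longleftrightarrow> psd B" for B :: "complex^'a^'a"
  proof
    assume "block_psd 1 (\<lambda>i j. B)"
    then show "psd B" unfolding block_psd_def psd_def by (auto dest: spec[of _ "\<lambda>_. _"])
  qed (simp add: block_psd_def psd_def)
  show ?thesis
    using assms unfolding completely_positive_def *[symmetric] by blast
qed

text \<open>The quadratic form at \<open>v\<close> is the trace of \<open>\<Phi> P ** X\<close> with
  the rank-one positive matrix \<open>P\<close> built from \<open>v\<close>, and the trace of a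
  product of two self-adjoint matrices is real.\<close>

lemma self_adjoint_hs_adjoint:
  assumes cp: "completely_positive \<Phi>" and X: "self_adjoint X"
  shows "self_adjoint (hs_adjoint \<Phi> X)"
proof (rule quad_form_real_imp_self_adjoint)
  fix v :: "complex^'a"
  define P :: "complex^'a^'a" where "P = (\<chi> i j. v $ i * cnj (v $ j))"
  have "cdot w (P *v w) = of_real ((cmod (cdot v w))\<^sup>2)" for w
  proof -
    have "cdot w (P *v w) = cdot w v * cdot v w"
      by (simp add: cdot_def P_def matrix_vector_mult_def sum_product sum_distrib_left mult_ac)
        (rule sum.swap)
    then show ?thesis
      by (simp add: complex_norm_square cnj_cdot mult.commute del: of_real_power)
  qed
  then have "psd P" unfolding psd_def by (simp del: of_real_power)
  then have sa: "self_adjoint P" "self_adjoint (\<Phi> P)"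
    using psd_imp_self_adjoint completely_positive_psd[OF cp] by blast+
  have "cdot v (hs_adjoint \<Phi> X *v v) = trace (P ** hs_adjoint \<Phi> X)"
    unfolding cdot_def trace_def P_def matrix_vector_mult_def matrix_matrix_mult_def
    by (simp add: sum_distrib_left mult_ac) (rule sum.swap)
  also have "\<dots> = trace (\<Phi> P ** X)"
    using hs_adjoint[of \<Phi> P X] cp sa by (simp add: completely_positive_def hs_inner_self_adjoint)
  finally have eq: "cdot v (hs_adjoint \<Phi> X *v v) = trace (\<Phi> P ** X)" .
  have "cnj (trace (\<Phi> P ** X)) = trace (mdagger (\<Phi> P ** X))"
    by (simp add: trace_def)
  also have "\<dots> = trace (X ** \<Phi> P)"
    using sa X by (simp add: mdagger_mult self_adjoint_def)
  also have "\<dots> = trace (\<Phi> P ** X)" by (rule trace_mul_sym)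
  finally show "cdot v (hs_adjoint \<Phi> X *v v) \<in> \<real>" unfolding eq by (simp add: Reals_cnj_iff)
qed

lemma mscale_linear_imp_linear:
  assumes "Vector_Spaces.linear mscale mscale \<Phi>"
  shows "linear \<Phi>"
proof -
  interpret \<Phi>: Vector_Spaces.linear mscale mscale \<Phi> by fact
  show ?thesis by (rule linearI) (simp_all add: \<Phi>.add \<Phi>.scale flip: mscale_of_real)
qed

subsection \<open>Perturbation of states\<close>

abbreviation re_tr :: "complex^'n^'n \<Rightarrow> complex^'n^'n \<Rightarrow> real" where
  "re_tr A B \<equiv> Re (trace (A ** B))"

lemma re_tr_simps:
  "re_tr (A + B) C = re_tr A C + re_tr B C"
  "re_tr (A - B) C = re_tr A C - re_tr B C"
  "re_tr C (A - B) = re_tr C A - re_tr C B"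
  "re_tr (r *\<^sub>R A) C = r * re_tr A C"
  by (simp_all add: matrix_add_rdistrib matrix_diff_ldistrib matrix_diff_rdistrib
      scaleR_matrix_mult trace_add trace_sub trace_scaleR)

lemma re_tr_scaleR_right: "re_tr C (r *\<^sub>R A) = r * re_tr C A"
  by (simp add: trace_mul_sym[of C] re_tr_simps)

lemma quad_form_scaleR: "cdot v ((r *\<^sub>R A) *v v) = of_real r * cdot v (A *v v)"
  by (simp add: cdot_def matrix_vector_mult_def sum_distrib_left scaleR_conv_of_real[where 'a=complex] mult_ac)

lemma states_mix:
  assumes "\<rho> \<in> states" "\<tau> \<in> states" "0 \<le> t" "t \<le> 1"
  shows "\<rho> + t *\<^sub>R (\<tau> - \<rho>) \<in> states"
proof -
  have "\<rho> + t *\<^sub>R (\<tau> - \<rho>) = (1 - t) *\<^sub>R \<rho> + t *\<^sub>R \<tau>" by (simp add: algebra_simps)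
  moreover have "psd ((1 - t) *\<^sub>R \<rho> + t *\<^sub>R \<tau>)"
    using assms unfolding psd_def states_def
    by (auto simp: matrix_vector_mult_add_rdistrib cdot_add_right quad_form_scaleR
        complex_nonneg_Reals_iff intro!: add_nonneg_nonneg)
  ultimately show ?thesis
    using assms by (simp add: states_def trace_add trace_sub trace_scaleR)
qed

text \<open>Klein's inequality read as convexity: \<open>matlog \<rho>\<close> acts as a
  subgradient. The identity in the true gradient is absent because it pairs to zero with differences
  of states.\<close>

lemma neg_entropy_gradient:
  assumes "\<rho> \<in> states" "posdef \<rho>" "\<tau> \<in> states"
  shows "neg_entropy \<rho> + re_tr (\<tau> - \<rho>) (matlog \<rho>) \<le> neg_entropy \<tau>"
  using klein_inequality(1)[OF assms(3,1,2)]
  by (simp add: rel_entropy_eq re_tr_simps) (simp add: neg_entropy_def)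

text \<open>The subgradient at \<open>\<Phi> \<rho>\<close> bounds the image entropy from below, the
  one at the perturbed state bounds its own entropy from above; maximality compares them and
  \<open>t\<close> is divided out. The right-hand logarithm sits at the perturbed state, so \<rho>
  itself may be singular.\<close>

lemma perturbation_inequality:
  assumes lin: "Vector_Spaces.linear mscale mscale \<Phi>" and sp: "strictly_positive \<Phi>" and c: "0 \<le> c"
    and max: "\<And>\<rho>'. \<rho>' \<in> states \<Longrightarrow>
      rel_entropy (\<Phi> \<rho>') \<sigma> - c * rel_entropy \<rho>' \<sigma> \<le> rel_entropy (\<Phi> \<rho>) \<sigma> - c * rel_entropy \<rho> \<sigma>"
    and \<rho>: "\<rho> \<in> states" and \<tau>: "\<tau> \<in> states" and t: "0 < t" "t \<le> 1"
    and pd: "posdef (\<rho> + t *\<^sub>R (\<tau> - \<rho>))"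
  shows "re_tr (\<Phi> \<tau> - \<Phi> \<rho>) (matlog (\<Phi> \<rho>) - matlog \<sigma>)
    \<le> c * re_tr (\<tau> - \<rho>) (matlog (\<rho> + t *\<^sub>R (\<tau> - \<rho>)) - matlog \<sigma>)"
proof -
  define \<rho>t where "\<rho>t = \<rho> + t *\<^sub>R (\<tau> - \<rho>)"
  interpret \<Phi>: linear \<Phi> using lin by (rule mscale_linear_imp_linear)
  have \<rho>t: "\<rho>t \<in> states" unfolding \<rho>t_def using \<rho> \<tau> t by (intro states_mix) auto
  have \<Phi>\<rho>: "\<Phi> \<rho> \<in> states" "posdef (\<Phi> \<rho>)" and \<Phi>\<rho>t: "\<Phi> \<rho>t \<in> states"
    using sp \<rho> \<rho>t full_rank_state_posdef unfolding strictly_positive_def by blast+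
  have \<Phi>t: "\<Phi> \<rho>t = \<Phi> \<rho> + t *\<^sub>R (\<Phi> \<tau> - \<Phi> \<rho>)"
    by (simp add: \<rho>t_def \<Phi>.add \<Phi>.diff \<Phi>.scale)
  have 1: "neg_entropy (\<Phi> \<rho>) + t * re_tr (\<Phi> \<tau> - \<Phi> \<rho>) (matlog (\<Phi> \<rho>)) \<le> neg_entropy (\<Phi> \<rho>t)"
    using neg_entropy_gradient[OF \<Phi>\<rho> \<Phi>\<rho>t] \<Phi>t by (simp add: re_tr_simps(4))
  have "\<rho> - \<rho>t = (- t) *\<^sub>R (\<tau> - \<rho>)" by (simp add: \<rho>t_def)
  moreover have "posdef \<rho>t" using pd by (simp only: \<rho>t_def)
  ultimately have 2: "neg_entropy \<rho>t - t * re_tr (\<tau> - \<rho>) (matlog \<rho>t) \<le> neg_entropy \<rho>"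
    using neg_entropy_gradient[OF \<rho>t _ \<rho>] by (simp only: re_tr_simps(4)) simp
  have 3: "c * (neg_entropy \<rho>t - t * re_tr (\<tau> - \<rho>) (matlog \<rho>t)) \<le> c * neg_entropy \<rho>"
    using 2 c by (rule mult_left_mono)
  have 4: "re_tr (\<Phi> \<rho>t) S = re_tr (\<Phi> \<rho>) S + t * re_tr (\<Phi> \<tau> - \<Phi> \<rho>) S"
    "re_tr \<rho>t S = re_tr \<rho> S + t * re_tr (\<tau> - \<rho>) S" for S
    unfolding \<Phi>t unfolding \<rho>t_def by (simp_all only: re_tr_simps(1,4))
  have "t * re_tr (\<Phi> \<tau> - \<Phi> \<rho>) (matlog (\<Phi> \<rho>) - matlog \<sigma>)
      \<le> t * (c * re_tr (\<tau> - \<rho>) (matlog \<rho>t - matlog \<sigma>))"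
    using max[OF \<rho>t] 1 3 unfolding rel_entropy_eq 4 re_tr_simps(3)
    by (simp add: right_diff_distrib distrib_left mult.left_commute)
  then show ?thesis using t unfolding \<rho>t_def by simp
qed

lemma conj_diag_affine:
  "conj_diag U l + t *\<^sub>R (conj_diag U m - conj_diag U l) = conj_diag U (\<lambda>i. l i + t * (m i - l i))"
  "conj_diag U m - conj_diag U l = conj_diag U (\<lambda>i. m i - l i)"
proof -
  have a: "U ** A ** V - U ** B ** V = U ** (A - B) ** V" and b: "U ** A ** V + t *\<^sub>R (U ** C ** V) = U ** (A + t *\<^sub>R C) ** V"
    for A B C V :: "complex^'a^'a"
    by (simp_all add: matrix_diff_ldistrib matrix_diff_rdistrib matrix_add_ldistrib matrix_add_rdistrib
        matrix_scalar_ac scaleR_matrix_mult)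
  show "conj_diag U m - conj_diag U l = conj_diag U (\<lambda>i. m i - l i)"
    unfolding a by (intro arg_cong[where f="\<lambda>X. U ** X ** mdagger U"]) (simp add: vec_eq_iff diag_real_def)
  show "conj_diag U l + t *\<^sub>R (conj_diag U m - conj_diag U l) = conj_diag U (\<lambda>i. l i + t * (m i - l i))"
    unfolding a b by (intro arg_cong[where f="\<lambda>X. U ** X ** mdagger U"])
      (simp add: vec_eq_iff diag_real_def scaleR_conv_of_real[where 'a=complex])
qed

lemma conj_diag_const:
  assumes "unitary_matrix U"
  shows "conj_diag U (\<lambda>_. c) = c *\<^sub>R mat 1"
proof -
  have "diag_real (\<lambda>_. c) = c *\<^sub>R (mat 1 :: complex^'a^'a)"
    by (simp add: vec_eq_iff diag_real_def mat_def) (simp add: scaleR_conv_of_real)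
  then show ?thesis
    using unitary_mult_cancel[OF assms] by (simp add: matrix_scalar_ac scaleR_matrix_mult)
qed

text \<open>
  At a singular state the derivative of the entropy towards the maximally mixed state is infinite,
  while that of the entropy of the image under \<open>\<Phi>\<close> stays finite.
\<close>

lemma maximiser_posdef:
  fixes \<Phi> :: "complex^'n^'n \<Rightarrow> complex^'n^'n"
  assumes lin: "Vector_Spaces.linear mscale mscale \<Phi>" and sp: "strictly_positive \<Phi>" and c: "0 < c"
    and max: "\<And>\<rho>'. \<rho>' \<in> states \<Longrightarrow>
      rel_entropy (\<Phi> \<rho>') \<sigma> - c * rel_entropy \<rho>' \<sigma> \<le> rel_entropy (\<Phi> \<rho>) \<sigma> - c * rel_entropy \<rho> \<sigma>"
    and \<rho>: "\<rho> \<in> states"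
  shows "posdef \<rho>"
proof (rule ccontr)
  assume npd: "\<not> posdef \<rho>"
  obtain U p where U: "unitary_matrix U" and \<rho>_eq: "\<rho> = conj_diag U p" and p: "\<And>i. 0 \<le> p i"
    and p1: "(\<Sum>i\<in>UNIV. p i) = 1" and ple: "\<And>i. p i \<le> 1" using states_spectral[OF \<rho>] by metis
  obtain k where k: "p k = 0"
    using npd p unfolding \<rho>_eq posdef_conj_diag_iff[OF U] by (metis less_le)
  \<comment> \<open>The eigenvalue of the maximally mixed state.\<close>
  define e where "e = 1 / real CARD('n)"
  have e: "0 < e" "e \<le> 1" by (simp_all add: e_def)
  define \<tau> where "\<tau> = conj_diag U (\<lambda>_. e)"
  have \<tau>: "\<tau> \<in> states"
    unfolding \<tau>_def conj_diag_in_states_iff[OF U] using e by (simp add: e_def)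
  \<comment> \<open>Since \<tau> commutes with \<rho>, these are the eigenvalues of the perturbed
    state.\<close>
  define x where "x t i = p i + t * (e - p i)" for t i
  \<comment> \<open>Bounds the contribution of all eigenvalues other than \<open>k\<close>,
    uniformly in \<open>t\<close>.\<close>
  define B where "B = (\<Sum>i\<in>UNIV - {k}. \<bar>e - p i\<bar> * \<bar>ln (p i / 2)\<bar>)"
  \<comment> \<open>Collects the terms of the perturbation inequality that do not depend on
    \<open>t\<close>, after division by \<open>c\<close>.\<close>
  define C where "C = re_tr (\<Phi> \<tau> - \<Phi> \<rho>) (matlog (\<Phi> \<rho>) - matlog \<sigma>) / c + re_tr (\<tau> - \<rho>) (matlog \<sigma>)"
  have bound: "C \<le> B + e * ln (t * e)" if t: "0 < t" "t \<le> 1 / 2" for t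
  proof -
    have x_lower: "t * e \<le> x t i" "p i / 2 \<le> x t i" and x_upper: "x t i \<le> 1" for i
    proof -
      have x_eq: "x t i = (1 - t) * p i + t * e" by (simp add: x_def algebra_simps)
      have "0 \<le> (1 - t) * p i" using t p[of i] by simp
      then show "t * e \<le> x t i" by (simp add: x_eq)
      have "1 / 2 * p i \<le> (1 - t) * p i" using t p[of i] by (intro mult_right_mono) auto
      then show "p i / 2 \<le> x t i" using t e by (simp add: x_eq add_increasing2)
      have "(1 - t) * p i + t * e \<le> (1 - t) * 1 + t * 1"
        using t e ple by (intro add_mono mult_left_mono) auto
      then show "x t i \<le> 1" by (simp add: x_eq)
    qed
    have x_pos: "0 < x t i" for i using x_lower(1)[of i] t e by (smt (verit) mult_pos_pos)
    have \<rho>t: "\<rho> + t *\<^sub>R (\<tau> - \<rho>) = conj_diag U (x t)"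
      unfolding \<rho>_eq \<tau>_def conj_diag_affine(1) x_def by simp
    have pd: "posdef (conj_diag U (x t))"
      unfolding posdef_conj_diag_iff[OF U] using x_pos by simp
    have "re_tr (\<Phi> \<tau> - \<Phi> \<rho>) (matlog (\<Phi> \<rho>) - matlog \<sigma>)
        \<le> c * re_tr (\<tau> - \<rho>) (matlog (\<rho> + t *\<^sub>R (\<tau> - \<rho>)) - matlog \<sigma>)"
      by (rule perturbation_inequality[OF lin sp _ max \<rho> \<tau>]) (use c t pd in \<open>simp_all add: \<rho>t\<close>)
    then have "C \<le> re_tr (\<tau> - \<rho>) (matlog (conj_diag U (x t)))"
      using c unfolding C_def \<rho>t re_tr_simps(3) by (simp add: field_simps)
    also have "\<dots> = (\<Sum>i\<in>UNIV. (e - p i) * ln (x t i))"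
      unfolding matlog_conj_diag[OF U] \<rho>_eq \<tau>_def conj_diag_affine(2) conj_diag_mult[OF U] trace_conj_diag[OF U]
      by (simp only: Re_complex_of_real)
    also have "\<dots> = e * ln (t * e) + (\<Sum>i\<in>UNIV - {k}. (e - p i) * ln (x t i))"
      by (subst sum.remove[of _ k]) (simp_all add: k x_def)
    also have "(\<Sum>i\<in>UNIV - {k}. (e - p i) * ln (x t i)) \<le> B"
      unfolding B_def
    proof (rule sum_mono)
      fix i
      show "(e - p i) * ln (x t i) \<le> \<bar>e - p i\<bar> * \<bar>ln (p i / 2)\<bar>"
      proof (cases "p i = 0")
        case True
        \<comment> \<open>Here the default \<open>ln 0 = 0\<close> makes the bound 0, so the sign of
          the left side is what counts: \<open>e > 0\<close> and
          \<open>ln (x t i) \<le> 0\<close>.\<close>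
        then show ?thesis using x_upper[of i] x_pos[of i] e by (simp add: mult_nonneg_nonpos)
      next
        case False
        then have "p i / 2 > 0" using p[of i] by simp
        then have "ln (p i / 2) \<le> ln (x t i)" "ln (x t i) \<le> 0"
          using x_lower(2)[of i] x_upper[of i] x_pos[of i] by simp_all
        then have "\<bar>ln (x t i)\<bar> \<le> \<bar>ln (p i / 2)\<bar>" by simp
        then have "\<bar>(e - p i) * ln (x t i)\<bar> \<le> \<bar>e - p i\<bar> * \<bar>ln (p i / 2)\<bar>"
          unfolding abs_mult by (intro mult_left_mono) auto
        then show ?thesis by linarith
      qed
    qed
    finally show ?thesis by simp
  qed
  \<comment> \<open>Small enough that \<open>e * ln (t * e)\<close> drops to
    \<open>C - B - 1\<close>, contradicting \<open>bound\<close>; the cap 1/2 keeps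
    \<open>bound\<close> applicable.\<close>
  define t where "t = min (1 / 2) (exp ((C - B - 1) / e))"
  have t: "0 < t" "t \<le> 1 / 2" by (simp_all add: t_def)
  have "t * e \<le> exp ((C - B - 1) / e)"
    using mult_mono[of t "exp ((C - B - 1) / e)" e 1] e by (simp add: t_def)
  then have "ln (t * e) \<le> ln (exp ((C - B - 1) / e))"
    using t e by (subst ln_le_cancel_iff) auto
  then have "ln (t * e) \<le> (C - B - 1) / e" by simp
  then have "e * ln (t * e) \<le> C - B - 1" using e by (simp add: field_simps)
  then show False using bound[OF t] by simp
qed

section \<open>First-order optimality at a full-rank maximiser\<close>

lemma posdef_lower_bound:
  assumes "\<rho> \<in> states" "posdef \<rho>"
  obtains a where "0 < a" "\<And>v. a * Re (cdot v v) \<le> Re (cdot v (\<rho> *v v))"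
proof -
  obtain U p where U: "unitary_matrix U" and \<rho>_eq: "\<rho> = conj_diag U p" and p: "\<And>i. 0 < p i"
    using posdef_states_spectral[OF assms] by metis
  define a where "a = Min (range p)"
  have a: "0 < a" "a \<le> p i" for i using p by (simp_all add: a_def)
  have "a * Re (cdot v v) \<le> Re (cdot v (\<rho> *v v))" for v
  proof -
    have "cdot v v = cdot v (conj_diag U (\<lambda>_. 1) *v v)"
      by (simp add: conj_diag_const[OF U])
    then have "a * Re (cdot v v) = (\<Sum>i\<in>UNIV. a * (cmod ((mdagger U *v v) $ i))\<^sup>2)"
      unfolding quad_form_conj_diag by (simp add: sum_distrib_left)
    also have "\<dots> \<le> (\<Sum>i\<in>UNIV. p i * (cmod ((mdagger U *v v) $ i))\<^sup>2)"
      by (intro sum_mono mult_right_mono a) simp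
    finally show ?thesis unfolding \<rho>_eq quad_form_conj_diag by (simp only: Re_complex_of_real)
  qed
  then show thesis using that a(1) by blast
qed

text \<open>The limit of the perturbation inequality as \<open>t\<close> tends to 0. Full rank of
  the maximiser keeps the logarithm continuous along the segment.\<close>

lemma maximiser_first_order:
  fixes \<Phi> :: "complex^'n^'n \<Rightarrow> complex^'n^'n"
  assumes lin: "Vector_Spaces.linear mscale mscale \<Phi>" and sp: "strictly_positive \<Phi>" and c: "0 < c"
    and max: "\<And>\<rho>'. \<rho>' \<in> states \<Longrightarrow>
      rel_entropy (\<Phi> \<rho>') \<sigma> - c * rel_entropy \<rho>' \<sigma> \<le> rel_entropy (\<Phi> \<rho>) \<sigma> - c * rel_entropy \<rho> \<sigma>"
    and \<rho>: "\<rho> \<in> states" and \<tau>: "\<tau> \<in> states"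
  shows "re_tr (\<Phi> \<tau> - \<Phi> \<rho>) (matlog (\<Phi> \<rho>) - matlog \<sigma>) \<le> c * re_tr (\<tau> - \<rho>) (matlog \<rho> - matlog \<sigma>)"
proof -
  have pd: "posdef \<rho>" using maximiser_posdef[OF lin sp c max \<rho>] .
  obtain a where a: "0 < a" "\<And>v. a * Re (cdot v v) \<le> Re (cdot v (\<rho> *v v))"
    using posdef_lower_bound[OF \<rho> pd] by metis
  define r where "r t = \<rho> + t *\<^sub>R (\<tau> - \<rho>)" for t
  \<comment> \<open>For \<open>t \<le> 1/2\<close> the quadratic form of \<open>r t\<close> is at
    least half that of \<rho>, so its eigenvalues stay above \<open>a / 2\<close>.\<close>
  have spec: "r t \<in> spectrum_in {a / 2..1}" "posdef (r t)" if t: "t \<in> {0..1/2}" for t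
  proof -
    have "r t \<in> states" unfolding r_def using t \<rho> \<tau> by (intro states_mix) auto
    then obtain V q where V: "unitary_matrix V" and r_eq: "r t = conj_diag V q" and q1: "\<And>i. q i \<le> 1"
      using states_spectral by metis
    have q: "a / 2 \<le> q i" for i
    proof -
      define v where "v = column i V"
      have v: "cdot v v = 1" using V by (simp add: v_def unitary_iff_orthonormal)
      have "r t = (1 - t) *\<^sub>R \<rho> + t *\<^sub>R \<tau>" by (simp add: r_def algebra_simps)
      then have "cdot v (r t *v v) = of_real (1 - t) * cdot v (\<rho> *v v) + of_real t * cdot v (\<tau> *v v)"
        by (simp only: matrix_vector_mult_add_rdistrib cdot_add_right quad_form_scaleR)
      then have "Re (cdot v (r t *v v)) = (1 - t) * Re (cdot v (\<rho> *v v)) + t * Re (cdot v (\<tau> *v v))"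
        by simp
      moreover have "Re (cdot v (r t *v v)) = q i"
        unfolding r_eq v_def quad_form_eigenvector[OF V] by simp
      moreover have "0 \<le> Re (cdot v (\<tau> *v v))"
        using \<tau> by (simp add: states_def psd_def complex_nonneg_Reals_iff)
      moreover have "1 / 2 * a \<le> (1 - t) * Re (cdot v (\<rho> *v v))"
        using t a(1) a(2)[of v] v by (intro mult_mono) auto
      ultimately show ?thesis using t by (simp add: add_increasing2)
    qed
    then show "r t \<in> spectrum_in {a / 2..1}"
      unfolding spectrum_in_def r_eq using V q1 by auto
    show "posdef (r t)"
      unfolding r_eq posdef_conj_diag_iff[OF V] using q a(1) by (meson half_gt_zero less_le_trans)
  qed
  have "continuous_on (spectrum_in {a / 2..1} :: (complex^'n^'n) set) matlog"
    unfolding matlog_def[abs_def]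
    by (rule continuous_on_matfun) (use a(1) in \<open>auto intro!: continuous_intros\<close>)
  then have "continuous_on {0..1/2} (\<lambda>t. matlog (r t))"
    by (rule continuous_on_compose2) (use spec in \<open>auto simp: r_def intro!: continuous_intros\<close>)
  then have cont: "continuous_on {0..1/2} (\<lambda>t. c * re_tr (\<tau> - \<rho>) (matlog (r t) - matlog \<sigma>))"
    by (intro continuous_intros)
  \<comment> \<open>The points \<open>1 / (n + 2)\<close> start at 1/2, so all of them lie in the
    range covered by \<open>spec\<close>.\<close>
  define s where "s n = inverse (real (Suc (Suc n)))" for n
  have s: "s n \<in> {0<..1/2}" for n by (auto simp: s_def field_simps)
  have "s \<longlonglongrightarrow> 0"
    unfolding s_def using LIMSEQ_Suc[OF LIMSEQ_inverse_real_of_nat] by simp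
  then have "(\<lambda>n. c * re_tr (\<tau> - \<rho>) (matlog (r (s n)) - matlog \<sigma>))
      \<longlonglongrightarrow> c * re_tr (\<tau> - \<rho>) (matlog (r 0) - matlog \<sigma>)"
    by (rule continuous_on_tendsto_compose[OF cont]) (use s in \<open>auto simp: less_imp_le\<close>)
  moreover have "re_tr (\<Phi> \<tau> - \<Phi> \<rho>) (matlog (\<Phi> \<rho>) - matlog \<sigma>)
      \<le> c * re_tr (\<tau> - \<rho>) (matlog (r (s n)) - matlog \<sigma>)" for n
    unfolding r_def
    by (rule perturbation_inequality[OF lin sp _ max \<rho> \<tau>])
       (use s[of n] c spec(2)[of "s n"] in \<open>auto simp: r_def\<close>)
  ultimately have "re_tr (\<Phi> \<tau> - \<Phi> \<rho>) (matlog (\<Phi> \<rho>) - matlog \<sigma>)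
      \<le> c * re_tr (\<tau> - \<rho>) (matlog (r 0) - matlog \<sigma>)"
    by (intro LIMSEQ_le_const) auto
  then show ?thesis by (simp add: r_def)
qed

text \<open>A linear functional that is maximal at an interior point of the states is constant
  there: its value is an average of eigenvalues of \<open>M\<close> with positive total weight on
  each, and none exceeds the average.\<close>

lemma maximal_at_posdef_imp_scalar:
  assumes \<rho>: "\<rho> \<in> states" "posdef \<rho>" and M: "self_adjoint M"
    and max: "\<And>\<tau>. \<tau> \<in> states \<Longrightarrow> re_tr \<tau> M \<le> re_tr \<rho> M"
  obtains c where "M = c *\<^sub>R mat 1"
proof -
  obtain V m where V: "unitary_matrix V" and M_eq: "M = conj_diag V m"
    using self_adjoint_diagonalization[OF M] by metis
  obtain U p where U: "unitary_matrix U" and \<rho>_eq: "\<rho> = conj_diag U p" and p: "\<And>i. 0 < p i"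
    and p1: "(\<Sum>i\<in>UNIV. p i) = 1" using posdef_states_spectral[OF \<rho>] by metis
  obtain w where w: "\<And>i j. 0 \<le> w i j" and w1: "\<And>i. (\<Sum>j\<in>UNIV. w i j) = 1"
    and w2: "\<And>j. (\<Sum>i\<in>UNIV. w i j) = 1"
    and tr: "\<And>l m. re_tr (conj_diag U l) (conj_diag V m) = (\<Sum>i\<in>UNIV. \<Sum>j\<in>UNIV. w i j * (l i * m j))"
    by (rule trace_conj_diag_mult[OF U V]) blast
  define c where "c = re_tr \<rho> M"
  have le: "m j \<le> c" for j
  proof -
    \<comment> \<open>The projection onto the \<open>j\<close>-th eigenvector of \<open>M\<close> is
      a state that attains \<open>m j\<close>.\<close>
    let ?\<tau> = "conj_diag V (\<lambda>i. if i = j then 1 else 0)"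
    have "?\<tau> \<in> states" unfolding conj_diag_in_states_iff[OF V] by simp
    then have "re_tr ?\<tau> M \<le> c" unfolding c_def by (rule max)
    moreover have "re_tr ?\<tau> M = m j"
      unfolding M_eq conj_diag_mult[OF V] trace_conj_diag[OF V] Re_complex_of_real
      by (simp add: if_distrib if_distribR cong: if_cong)
    ultimately show ?thesis by simp
  qed
  define T where "T i j = w i j * (p i * (c - m j))" for i j
  have nn: "0 \<le> T i j" for i j
    unfolding T_def using w[of i j] p[of i] le[of j] by simp
  have "(\<Sum>i\<in>UNIV. \<Sum>j\<in>UNIV. T i j) = (\<Sum>i\<in>UNIV. \<Sum>j\<in>UNIV. w i j * (p i * c)) - re_tr \<rho> M"
    unfolding \<rho>_eq M_eq tr T_def by (simp add: right_diff_distrib sum_subtractf)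
  also have "(\<Sum>i\<in>UNIV. \<Sum>j\<in>UNIV. w i j * (p i * c)) = c"
    using w1 p1 by (simp flip: sum_distrib_right)
  finally have "(\<Sum>i\<in>UNIV. \<Sum>j\<in>UNIV. T i j) = 0" by (simp add: c_def)
  then have "(\<Sum>j\<in>UNIV. T i j) = 0" for i
    using sum_nonneg_eq_0_iff[of UNIV "\<lambda>i. \<Sum>j\<in>UNIV. T i j"] nn by (simp add: sum_nonneg)
  then have T0: "T i j = 0" for i j
    using sum_nonneg_eq_0_iff[of UNIV "T i"] nn by simp
  have "m j = c" for j
  proof (rule ccontr)
    assume "m j \<noteq> c"
    then have "w i j = 0" for i using T0[of i j] p[of i] by (auto simp: T_def)
    then show False using w2[of j] by simp
  qed
  then have "m = (\<lambda>_. c)" by auto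
  then have "M = c *\<^sub>R mat 1" by (simp only: M_eq conj_diag_const[OF V])
  then show thesis by (rule that)
qed

text \<open>\<open>b\<close> is the Lagrange multiplier of the constraint that the trace is one. The
  hypothesis on \<open>\<rho>\<^sub>0\<close> makes the maximum positive, which separates the
  maximiser from \<sigma>.\<close>

theorem extremal_state:
  fixes \<Phi> :: "complex^'n^'n \<Rightarrow> complex^'n^'n"
  assumes cp: "completely_positive \<Phi>" and sp: "strictly_positive \<Phi>" and c: "0 < c"
    and \<sigma>: "\<sigma> \<in> states" "\<Phi> \<sigma> = \<sigma>"
    and \<rho>\<^sub>0: "\<rho>\<^sub>0 \<in> states" "c * rel_entropy \<rho>\<^sub>0 \<sigma> < rel_entropy (\<Phi> \<rho>\<^sub>0) \<sigma>"
  obtains \<rho> b where "\<rho> \<in> states" "posdef \<rho>" "\<rho> \<noteq> \<sigma>"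
    "hs_adjoint \<Phi> (matlog (\<Phi> \<rho>) - matlog \<sigma>) - c *\<^sub>R (matlog \<rho> - matlog \<sigma>) = b *\<^sub>R mat 1"
proof -
  have lin: "Vector_Spaces.linear mscale mscale \<Phi>" using cp by (simp add: completely_positive_def)
  have \<Phi>: "\<Phi> \<rho> \<in> states" if "\<rho> \<in> states" for \<rho>
    using sp that by (simp add: strictly_positive_def)
  define F where "F \<rho> = rel_entropy (\<Phi> \<rho>) \<sigma> - c * rel_entropy \<rho> \<sigma>" for \<rho>
  have "continuous_on states \<Phi>"
    using mscale_linear_imp_linear[OF lin] linear_continuous_on linear_conv_bounded_linear by blast
  then have "continuous_on states F"
    unfolding F_def rel_entropy_eq
    by (intro continuous_intros continuous_on_neg_entropy
        continuous_on_compose2[OF continuous_on_neg_entropy]) (use \<Phi> in auto)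
  then obtain \<rho> where \<rho>: "\<rho> \<in> states" and max: "\<And>\<rho>'. \<rho>' \<in> states \<Longrightarrow> F \<rho>' \<le> F \<rho>"
    using continuous_attains_sup[OF compact_states, of F] \<rho>\<^sub>0(1) by blast
  note max' = max[unfolded F_def]
  have pd: "posdef \<rho>" using maximiser_posdef[OF lin sp c max' \<rho>] .
  have "0 < F \<rho>" using max[OF \<rho>\<^sub>0(1)] \<rho>\<^sub>0(2) by (simp add: F_def)
  moreover have "F \<sigma> = 0" by (simp add: F_def \<sigma>(2) rel_entropy_def trace_def)
  ultimately have "\<rho> \<noteq> \<sigma>" by auto
  define X Y where "X = matlog (\<Phi> \<rho>) - matlog \<sigma>" and "Y = matlog \<rho> - matlog \<sigma>"
  have XY: "self_adjoint X" "self_adjoint Y"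
    unfolding X_def Y_def using \<Phi>[OF \<rho>] \<rho> \<sigma>(1)
    by (simp_all add: self_adjoint_diff self_adjoint_matlog states_imp_self_adjoint)
  \<comment> \<open>Up to a multiple of the identity, the gradient of \<open>F\<close> at the
    maximiser.\<close>
  define M where "M = hs_adjoint \<Phi> X - c *\<^sub>R Y"
  have M: "self_adjoint M"
    unfolding M_def using XY self_adjoint_hs_adjoint[OF cp] self_adjoint_diff self_adjoint_scaleR by blast
  have pairing: "re_tr \<tau> M = re_tr (\<Phi> \<tau>) X - c * re_tr \<tau> Y" if "\<tau> \<in> states" for \<tau>
    using hs_adjoint[OF lin, of \<tau> X] that \<Phi>[OF that]
    by (simp add: M_def re_tr_simps(3) re_tr_scaleR_right hs_inner_self_adjoint states_imp_self_adjoint)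
  have "re_tr \<tau> M \<le> re_tr \<rho> M" if "\<tau> \<in> states" for \<tau>
    using maximiser_first_order[OF lin sp c max' \<rho> that]
    unfolding pairing[OF that] pairing[OF \<rho>] X_def[symmetric] Y_def[symmetric] re_tr_simps(2)
    by (simp add: algebra_simps)
  then obtain b where "M = b *\<^sub>R mat 1"
    using maximal_at_posdef_imp_scalar[OF \<rho> pd M] by blast
  then show thesis using that \<rho> pd \<open>\<rho> \<noteq> \<sigma>\<close> unfolding M_def X_def Y_def by blast
qed

subsection \<open>Lipschitz semi-norms\<close>

text \<open>The relative entropies in the two directions equal \<open>Re c\<close> and
  \<open>- Re c\<close>; both are nonnegative, hence zero.\<close>

lemma matlog_diff_scalar_imp_eq:
  assumes "\<rho> \<in> states" "posdef \<rho>" "\<sigma> \<in> states" "posdef \<sigma>"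
    and eq: "matlog \<rho> - matlog \<sigma> = mscale c (mat 1)"
  shows "\<rho> = \<sigma>"
proof -
  have tr: "re_tr A (mscale c (mat 1)) = Re (c * trace A)" for A :: "complex^'a^'a"
  proof -
    have "A ** mscale c (mat 1) = mscale c A"
      by (simp add: vec_eq_iff mscale_def matrix_matrix_mult_def mat_def if_distrib if_distribR mult.commute cong: if_cong)
    then show ?thesis by (simp add: mscale_def trace_def sum_distrib_left)
  qed
  have "rel_entropy \<rho> \<sigma> = Re c"
    unfolding rel_entropy_def eq tr using assms(1) by (simp add: states_def)
  moreover have "rel_entropy \<sigma> \<rho> = - re_tr \<sigma> (matlog \<rho> - matlog \<sigma>)"
    unfolding rel_entropy_def by (simp add: re_tr_simps)
  then have "rel_entropy \<sigma> \<rho> = - Re c"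
    unfolding eq tr using assms(3) by (simp add: states_def)
  ultimately have "rel_entropy \<rho> \<sigma> = 0"
    using klein_inequality(1)[of \<rho> \<sigma>] klein_inequality(1)[of \<sigma> \<rho>] assms by simp
  then show ?thesis using klein_inequality(2) assms by blast
qed

lemma lipschitz_seminormD:
  assumes "lipschitz_seminorm L"
  shows "0 \<le> L x" "L (x + y) \<le> L x + L y" "L (r *\<^sub>R x) = \<bar>r\<bar> * L x"
    "L (mscale c (mat 1)) = 0"
  using assms mscale_of_real[of r x, symmetric] unfolding lipschitz_seminorm_def by simp_all

text \<open>The zero matrix is always an admissible argument of the supremum.\<close>

lemma Lip_nonneg:
  assumes "lipschitz_seminorm L"
  shows "0 \<le> Lip L \<Psi>"
proof -
  have "ereal (L (\<Psi> 0)) \<le> Lip L \<Psi>"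
    unfolding Lip_def
    using lipschitz_seminormD(3)[OF assms, of 0 0]
    by (intro SUP_upper) (simp add: self_adjoint_def vec_eq_iff)
  then show ?thesis using lipschitz_seminormD(1)[OF assms] by (metis ereal_less_eq(5) order_trans)
qed

text \<open>Scaling to semi-norm one needs \<open>L x\<close> positive. If \<open>L x\<close> is
  zero, \<open>x\<close> is scalar and is fixed by the unital adjoint.\<close>

lemma Lip_hs_adjoint_bound:
  assumes L: "lipschitz_seminorm L" and nondegenerate: "\<And>x. L x = 0 \<Longrightarrow> \<exists>c. x = mscale c (mat 1)"
    and lin: "Vector_Spaces.linear mscale mscale \<Phi>" and tp: "trace_preserving \<Phi>"
    and x: "self_adjoint x"
  shows "ereal (L (hs_adjoint \<Phi> x)) \<le> Lip L (hs_adjoint \<Phi>) * ereal (L x)"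
proof (cases "L x = 0")
  case True
  then obtain c where "x = mscale c (mat 1)" using nondegenerate by blast
  then show ?thesis
    using hs_adjoint_unital[OF lin tp] lipschitz_seminormD(4)[OF L] by (simp flip: zero_ereal_def)
next
  case False
  then have pos: "0 < L x" using lipschitz_seminormD(1)[OF L, of x] by simp
  define y where "y = inverse (L x) *\<^sub>R x"
  have "L y = 1" using pos by (simp add: y_def lipschitz_seminormD(3)[OF L])
  then have "ereal (L (hs_adjoint \<Phi> y)) \<le> Lip L (hs_adjoint \<Phi>)"
    unfolding Lip_def using x by (intro SUP_upper) (simp add: y_def self_adjoint_scaleR)
  then have "ereal (L (hs_adjoint \<Phi> y)) * ereal (L x) \<le> Lip L (hs_adjoint \<Phi>) * ereal (L x)"
    using pos by (intro ereal_mult_right_mono) simp_all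
  \<comment> \<open>Real homogeneity of the adjoint, read off from its defining pairing.\<close>
  moreover have "hs_adjoint \<Phi> y = inverse (L x) *\<^sub>R hs_adjoint \<Phi> x"
  proof (rule hs_inner_eqI)
    fix X
    have *: "hs_inner Z (r *\<^sub>R B) = r *\<^sub>R hs_inner Z B" for Z B :: "complex^'a^'a" and r
      by (simp add: hs_inner_eq_sum scaleR_sum_right)
    show "hs_inner X (hs_adjoint \<Phi> y) = hs_inner X (inverse (L x) *\<^sub>R hs_adjoint \<Phi> x)"
      unfolding y_def * hs_adjoint[OF lin, symmetric] ..
  qed
  moreover have "inverse (L x) * L (hs_adjoint \<Phi> x) * L x = L (hs_adjoint \<Phi> x)"
    using pos by (simp add: field_simps)
  ultimately show ?thesis using pos by (simp add: lipschitz_seminormD(3)[OF L])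
qed

text \<open>A positive denominator excludes the quotient 0/0, so \<rho> is an index of the
  supremum.\<close>

lemma LogLip_bound:
  assumes "\<rho> \<in> states" "posdef \<rho>" and pos: "0 < L (matlog \<rho> - matlog \<sigma>)"
  shows "ereal (L (matlog (\<Phi> \<rho>) - matlog \<sigma>)) \<le> LogLip L \<Phi> \<sigma> * ereal (L (matlog \<rho> - matlog \<sigma>))"
proof -
  have "ereal (L (matlog (\<Phi> \<rho>) - matlog \<sigma>)) / ereal (L (matlog \<rho> - matlog \<sigma>)) \<le> LogLip L \<Phi> \<sigma>"
    unfolding LogLip_def using assms by (intro SUP_upper) auto
  then show ?thesis using pos by (subst (asm) ereal_divide_le_pos) (simp_all add: mult.commute)
qed

theorem theorem1p4:
  fixes \<Phi> :: "complex^'n^'n \<Rightarrow> complex^'n^'n"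
    and \<sigma> :: "complex^'n^'n"
    and L :: "complex^'n^'n \<Rightarrow> real"
  assumes "completely_positive \<Phi>" and "trace_preserving \<Phi>"
    and "unique_fixed_state \<Phi> \<sigma>" and "full_rank \<sigma>"
    and "strictly_positive \<Phi>"
    and "lipschitz_seminorm L"
    and nondegenerate: "\<And>x. L x = 0 \<Longrightarrow> \<exists>c. x = mscale c (mat 1)"
  shows "eta_D \<Phi> \<sigma> \<le> Lip L (hs_adjoint \<Phi>) * max (Lip L (bkm_adjoint \<Phi> \<sigma>)) (LogLip L \<Phi> \<sigma>)"
proof (rule ccontr)
  note cp = \<open>completely_positive \<Phi>\<close> and tp = \<open>trace_preserving \<Phi>\<close> and sp = \<open>strictly_positive \<Phi>\<close>
    and L = lipschitz_seminormD[OF \<open>lipschitz_seminorm L\<close>]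
  have lin: "Vector_Spaces.linear mscale mscale \<Phi>" using cp by (simp add: completely_positive_def)
  have \<sigma>: "\<sigma> \<in> states" "\<Phi> \<sigma> = \<sigma>"
    using \<open>unique_fixed_state \<Phi> \<sigma>\<close> by (simp_all add: unique_fixed_state_def)
  have \<sigma>_pd: "posdef \<sigma>" using full_rank_state_posdef \<sigma>(1) \<open>full_rank \<sigma>\<close> by blast
  define A where "A = Lip L (hs_adjoint \<Phi>)"
  define K where "K = max (Lip L (bkm_adjoint \<Phi> \<sigma>)) (LogLip L \<Phi> \<sigma>)"
  have A: "0 \<le> A" unfolding A_def by (rule Lip_nonneg) fact
  \<comment> \<open>The BKM term guards the maximum from below: \<open>LogLip\<close> can be a
    supremum over the empty set, which is minus infinity.\<close>
  have K: "0 \<le> K" unfolding K_def using Lip_nonneg[OF \<open>lipschitz_seminorm L\<close>] by (simp add: le_max_iff_disj)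
  assume "\<not> ?thesis"
  then have "A * K < eta_D \<Phi> \<sigma>" by (simp add: A_def K_def not_le)
  then obtain \<rho>\<^sub>0 where \<rho>\<^sub>0: "\<rho>\<^sub>0 \<in> states" "\<rho>\<^sub>0 \<noteq> \<sigma>"
    and less: "A * K < ereal (rel_entropy (\<Phi> \<rho>\<^sub>0) \<sigma>) / ereal (rel_entropy \<rho>\<^sub>0 \<sigma>)"
    unfolding eta_D_def less_SUP_iff by blast
  define e0 e1 where "e0 = rel_entropy \<rho>\<^sub>0 \<sigma>" and "e1 = rel_entropy (\<Phi> \<rho>\<^sub>0) \<sigma>"
  have e0: "0 < e0"
    using klein_inequality[OF \<rho>\<^sub>0(1) \<sigma>(1) \<sigma>_pd] \<rho>\<^sub>0(2) by (force simp: e0_def)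
  then have less': "A * K < ereal (e1 / e0)" using less by (simp add: e0_def e1_def)
  have AK: "0 \<le> A * K" using A K by simp
  \<comment> \<open>The product is nonnegative and lies below a real quotient, hence is
    finite.\<close>
  obtain k where k: "A * K = ereal k"
    using AK less' by (cases "A * K") auto
  have "0 \<le> k" "k < e1 / e0" using AK less' by (simp_all add: k)
  then obtain c where c: "k < c" "c < e1 / e0" "0 < c"
    using dense[of k "e1 / e0"] by auto
  have "c * rel_entropy \<rho>\<^sub>0 \<sigma> < rel_entropy (\<Phi> \<rho>\<^sub>0) \<sigma>"
    using c(2) e0 by (simp add: e0_def[symmetric] e1_def[symmetric] pos_less_divide_eq)
  then obtain \<rho> b where \<rho>: "\<rho> \<in> states" "posdef \<rho>" "\<rho> \<noteq> \<sigma>" and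
    eq: "hs_adjoint \<Phi> (matlog (\<Phi> \<rho>) - matlog \<sigma>) - c *\<^sub>R (matlog \<rho> - matlog \<sigma>) = b *\<^sub>R mat 1"
    using extremal_state[OF cp sp c(3) \<sigma> \<rho>\<^sub>0(1)] by metis
  define X Y where "X = matlog (\<Phi> \<rho>) - matlog \<sigma>" and "Y = matlog \<rho> - matlog \<sigma>"
  \<comment> \<open>Otherwise the two logarithms would differ by a scalar and \<rho> would equal
    \<sigma>.\<close>
  have "L Y \<noteq> 0"
    using nondegenerate matlog_diff_scalar_imp_eq[OF \<rho>(1,2) \<sigma>(1) \<sigma>_pd] \<rho>(3) unfolding Y_def by blast
  then have LY: "0 < L Y" using L(1)[of Y] by simp
  have X: "self_adjoint X"
    unfolding X_def using sp \<rho>(1) \<sigma>(1)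
    by (simp add: strictly_positive_def self_adjoint_diff self_adjoint_matlog states_imp_self_adjoint)
  \<comment> \<open>The semi-norm of the scalar term vanishes, so the triangle inequality compares
    \<open>Y\<close> with the image of \<open>X\<close> alone.\<close>
  have "c *\<^sub>R Y = hs_adjoint \<Phi> X + mscale (of_real (- b)) (mat 1)"
    using eq by (simp add: X_def Y_def mscale_of_real algebra_simps del: of_real_minus)
  then have "c * L Y \<le> L (hs_adjoint \<Phi> X)"
    using L(2)[of "hs_adjoint \<Phi> X" "mscale (of_real (- b)) (mat 1)"] L(3)[of c Y] L(4) c(3) by simp
  then have "ereal (c * L Y) \<le> ereal (L (hs_adjoint \<Phi> X))" by simp
  also have "\<dots> \<le> A * ereal (L X)"
    unfolding A_def by (rule Lip_hs_adjoint_bound) (fact \<open>lipschitz_seminorm L\<close> nondegenerate lin tp X)+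
  also have "\<dots> \<le> A * (K * ereal (L Y))"
  proof (rule ereal_mult_left_mono[OF _ A])
    have "ereal (L X) \<le> LogLip L \<Phi> \<sigma> * ereal (L Y)"
      unfolding X_def Y_def using \<rho> LY by (intro LogLip_bound) (simp_all add: Y_def)
    also have "\<dots> \<le> K * ereal (L Y)"
      using LY by (intro ereal_mult_right_mono) (simp_all add: K_def)
    finally show "ereal (L X) \<le> K * ereal (L Y)" .
  qed
  \<comment> \<open>Reassociating uses only that \<open>A * K\<close> is finite; one factor may be
    infinite when the other is 0. The chain gives \<open>c * L Y \<le> k * L Y\<close> against
    \<open>k < c\<close>.\<close>
  also have "\<dots> = ereal (k * L Y)" by (simp add: mult.assoc[symmetric] k)
  finally show False using c(1) LY by simp
qed

end
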